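(* (1) A braid $\beta\in B_3$ is conjugate to an almost strongly quasipositive braid but not to a strongly quasipositive braid if and only if every $\beta'\in\mathtt{SSS}([\beta])$ has $\inf(\beta')=-1$. (2) A braid $\beta\in B_4$ is conjugate to an almost strongly quasipositive braid but not to a strongly quasipositive braid if and only if every $\beta'\in\mathtt{SSS}([\beta])$ has $\inf(\beta')=-1$ and its left-canonical form $\delta^{-1}A_1\cdots A_k$ contains a canonical factor $A_i$ with $\|A_i\|=2$.
   Context: $B_n$ is the braid group on $n$ strands with Artin generators $\sigma_1,\dots,\sigma_{n-1}$. For $1\le i<j\le n$ the band generator is $a_{ij}=(\sigma_{j-1}\sigma_{j-2}\cdots\sigma_{i+1})\,\sigma_i\,(\sigma_{j-1}\sigma_{j-2}\cdots\sigma_{i+1})^{-1}$. A braid word means a word in the $a_{ij}^{\pm1}$; the letters $a_{ij}$ are positive bands, the letters $a_{ij}^{-1}$ negative bands. $\|\beta\|$ is the minimal length of a braid word representing $\beta$. A braid is strongly quasipositive (SQP) if it is represented by a (possibly empty) word with no negative bands, and almost strongly quasipositive (ASQP) if it is represented by a word with at most one negative band. $SQP(n)\subset B_n$ is the monoid of SQP braids. For $V,W\in B_n$ write $V\le W$ if $W=PVQ$ for some $P,Q\in SQP(n)$. Let $\delta=\sigma_{n-1}\cdots\sigma_2\sigma_1$, $\inf(\beta)=\max\{r\in\mathbb Z:\delta^r\le\beta\}$, $\sup(\beta)=\min\{s\in\mathbb Z:\beta\le\delta^s\}$, $\ell(\beta)=\sup(\beta)-\inf(\beta)$. A canonical factor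 is a braid $A$ with $e\le A\le\delta$, where $e$ is the identity; for canonical factors write $A\prec A'$ if $A'=AQ$ for some canonical factor $Q$. For canonical factors $A,B$ the product $AB$ is maximally left-weighted if there are no canonical factors $A',B'$ with $A'\ne A$, $A\prec A'$ and $AB=A'B'$. Every $\beta\in B_n$ has a unique expression $\beta=\delta^rA_1\cdots A_k$ with $r\in\mathbb Z$, $k\ge0$, each $A_i$ a canonical factor different from $e,\delta$, and each $A_iA_{i+1}$ maximally left-weighted; this is the left-canonical form of $\beta$, and $r=\inf(\beta)$, $k=\ell(\beta)$. $[\beta]$ is the conjugacy class of $\beta$. The super summit set $\mathtt{SSS}([\beta])$ is the set of conjugates $\beta'$ of $\beta$ with $\ell(\beta')$ minimal among all conjugates of $\beta$.
   Formalization: In part (1), braids conjugate to δ⁻¹ in B_3 are excluded: for them every element of SSS has inf = −1, yet their exponent sum −2 rules out being conjugate to an almost strongly quasipositive braid, so the claim as printed fails. *)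

theory Defs
  imports "HOL-Algebra.Group"
begin

section \<open>The braid group\<close>

text \<open>
  The braid group on \<open>n\<close> strands is Artin's presentation: the letter \<open>(True, i)\<close> stands for
  the generator \<open>\<sigma>\<^sub>i\<close> and \<open>(False, i)\<close> for its inverse, with \<open>1 \<le> i < n\<close>, and group elements are
  the classes of words modulo the congruence generated by free cancellation and the braid
  relations.  All intermediate words of a derivation use only the letters available on
  \<open>n\<close> strands.
\<close>

type_synonym artin_word = "(bool \<times> nat) list"

definition artin_words :: "nat \<Rightarrow> artin_word set" where
  "artin_words n = lists (UNIV \<times> {1..<n})"

inductive_set artin_rel :: "nat \<Rightarrow> (artin_word \<times> artin_word) set" for n :: nat where
  refl: "w \<in> artin_words n \<Longrightarrow> (w, w) \<in> artin_rel n"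
| sym: "(u, v) \<in> artin_rel n \<Longrightarrow> (v, u) \<in> artin_rel n"
| trans: "(u, v) \<in> artin_rel n \<Longrightarrow> (v, w) \<in> artin_rel n \<Longrightarrow> (u, w) \<in> artin_rel n"
| cong: "(u, u') \<in> artin_rel n \<Longrightarrow> (v, v') \<in> artin_rel n \<Longrightarrow> (u @ v, u' @ v') \<in> artin_rel n"
| cancel: "i \<in> {1..<n} \<Longrightarrow> ([(b, i), (\<not> b, i)], []) \<in> artin_rel n"
| far: "i \<in> {1..<n} \<Longrightarrow> j \<in> {1..<n} \<Longrightarrow> i + 2 \<le> j \<Longrightarrow>
    ([(True, i), (True, j)], [(True, j), (True, i)]) \<in> artin_rel n"
| braid: "i \<in> {1..<n} \<Longrightarrow> Suc i \<in> {1..<n} \<Longrightarrow>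
    ([(True, i), (True, Suc i), (True, i)],
     [(True, Suc i), (True, i), (True, Suc i)]) \<in> artin_rel n"

definition braid_group :: "nat \<Rightarrow> artin_word set monoid" where
  "braid_group n =
    \<lparr>carrier = artin_words n // artin_rel n,
     mult = (\<lambda>X Y. \<Union>u\<in>X. \<Union>v\<in>Y. artin_rel n `` {u @ v}),
     one = artin_rel n `` {[]}\<rparr>"

lemma artin_words_append [simp]:
  "u @ v \<in> artin_words n \<longleftrightarrow> u \<in> artin_words n \<and> v \<in> artin_words n"
  by (auto simp: artin_words_def)

lemma artin_words_Nil [simp]: "[] \<in> artin_words n"
  by (simp add: artin_words_def)

lemma artin_rel_words:
  "(u, v) \<in> artin_rel n \<Longrightarrow> u \<in> artin_words n \<and> v \<in> artin_words n"
  by (induction rule: artin_rel.induct) (auto simp: artin_words_def)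

lemma equiv_artin_rel: "equiv (artin_words n) (artin_rel n)"
proof (rule equivI)
  show "artin_rel n \<subseteq> artin_words n \<times> artin_words n"
    using artin_rel_words by auto
  show "refl_on (artin_words n) (artin_rel n)"
    by (rule refl_onI) (rule artin_rel.refl)
  show "sym (artin_rel n)"
    by (rule symI) (rule artin_rel.sym)
  show "trans (artin_rel n)"
    by (rule transI) (rule artin_rel.trans)
qed

lemma mult_class_artin_rel:
  assumes "u \<in> artin_words n" "v \<in> artin_words n"
  shows "artin_rel n `` {u} \<otimes>\<^bsub>braid_group n\<^esub> artin_rel n `` {v} = artin_rel n `` {u @ v}"
proof -
  have "artin_rel n `` {u' @ v'} = artin_rel n `` {u @ v}"
    if "(u, u') \<in> artin_rel n" "(v, v') \<in> artin_rel n" for u' v'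
    using equiv_class_eq[OF equiv_artin_rel artin_rel.cong[OF that]] by simp
  moreover have "(u, u) \<in> artin_rel n" "(v, v) \<in> artin_rel n"
    using assms by (auto intro: artin_rel.refl)
  ultimately show ?thesis
    unfolding braid_group_def monoid.simps by blast
qed

lemma carrier_braid_group:
  "carrier (braid_group n) = (\<lambda>w. artin_rel n `` {w}) ` artin_words n"
  by (auto simp: braid_group_def quotient_def)

definition inverse_word :: "artin_word \<Rightarrow> artin_word" where
  "inverse_word w = rev (map (\<lambda>(b, i). (\<not> b, i)) w)"

lemma inverse_word_in_artin_words: "w \<in> artin_words n \<Longrightarrow> inverse_word w \<in> artin_words n"
  by (fastforce simp: artin_words_def inverse_word_def in_lists_conv_set)

lemma inverse_word_left:
  "w \<in> artin_words n \<Longrightarrow> (inverse_word w @ w, []) \<in> artin_rel n"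
proof (induction w)
  case Nil
  then show ?case by (simp add: inverse_word_def artin_rel.refl)
next
  case (Cons x w)
  obtain b i where x: "x = (b, i)" by (cases x)
  have i: "i \<in> {1..<n}" and w: "w \<in> artin_words n"
    using Cons.prems by (auto simp: x artin_words_def)
  have "([(\<not> b, i), (\<not> \<not> b, i)] @ w, [] @ w) \<in> artin_rel n"
    by (intro artin_rel.cong artin_rel.cancel artin_rel.refl i w)
  then have "(inverse_word w @ [(\<not> b, i), (b, i)] @ w, inverse_word w @ w) \<in> artin_rel n"
    using artin_rel.cong[OF artin_rel.refl[OF inverse_word_in_artin_words[OF w]]] by fastforce
  then show ?case
    using artin_rel.trans[OF _ Cons.IH[OF w]] by (simp add: inverse_word_def x)
qed

lemma group_braid_group: "group (braid_group n)"
proof (rule groupI)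
  fix X Y assume "X \<in> carrier (braid_group n)" "Y \<in> carrier (braid_group n)"
  then show "X \<otimes>\<^bsub>braid_group n\<^esub> Y \<in> carrier (braid_group n)"
    by (auto simp: carrier_braid_group mult_class_artin_rel)
next
  show "\<one>\<^bsub>braid_group n\<^esub> \<in> carrier (braid_group n)"
    by (auto simp: carrier_braid_group) (auto simp: braid_group_def)
next
  fix X Y Z
  assume "X \<in> carrier (braid_group n)" "Y \<in> carrier (braid_group n)" "Z \<in> carrier (braid_group n)"
  then show "X \<otimes>\<^bsub>braid_group n\<^esub> Y \<otimes>\<^bsub>braid_group n\<^esub> Z =
      X \<otimes>\<^bsub>braid_group n\<^esub> (Y \<otimes>\<^bsub>braid_group n\<^esub> Z)"
    by (auto simp: carrier_braid_group mult_class_artin_rel)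
next
  have one: "\<one>\<^bsub>braid_group n\<^esub> = artin_rel n `` {[]}"
    by (simp add: braid_group_def)
  fix X assume "X \<in> carrier (braid_group n)"
  then obtain w where w: "w \<in> artin_words n" "X = artin_rel n `` {w}"
    by (auto simp: carrier_braid_group)
  then show "\<one>\<^bsub>braid_group n\<^esub> \<otimes>\<^bsub>braid_group n\<^esub> X = X"
    by (simp add: one mult_class_artin_rel)
  have "artin_rel n `` {inverse_word w} \<otimes>\<^bsub>braid_group n\<^esub> X = \<one>\<^bsub>braid_group n\<^esub>"
    using w inverse_word_in_artin_words[OF w(1)]
      equiv_class_eq[OF equiv_artin_rel inverse_word_left[OF w(1)]]
    by (simp add: one mult_class_artin_rel)
  then show "\<exists>Y\<in>carrier (braid_group n). Y \<otimes>\<^bsub>braid_group n\<^esub> X = \<one>\<^bsub>braid_group n\<^esub>"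
    using inverse_word_in_artin_words[OF w(1)] by (auto simp: carrier_braid_group)
qed


section \<open>Band generators and band words\<close>

definition braid_prod :: "nat \<Rightarrow> artin_word set list \<Rightarrow> artin_word set" where
  "braid_prod n xs = foldr (\<lambda>x y. x \<otimes>\<^bsub>braid_group n\<^esub> y) xs \<one>\<^bsub>braid_group n\<^esub>"

definition artin_gen :: "nat \<Rightarrow> nat \<Rightarrow> artin_word set" where
  "artin_gen n i = artin_rel n `` {[(True, i)]}"

text \<open>\<open>gen_desc n i j\<close> is \<open>\<sigma>\<^bsub>j-1\<^esub> \<sigma>\<^bsub>j-2\<^esub> \<cdots> \<sigma>\<^sub>i\<close>, the identity if \<open>i = j\<close>.\<close>

definition gen_desc :: "nat \<Rightarrow> nat \<Rightarrow> nat \<Rightarrow> artin_word set" where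
  "gen_desc n i j = braid_prod n (map (artin_gen n) (rev [i..<j]))"

definition band :: "nat \<Rightarrow> nat \<Rightarrow> nat \<Rightarrow> artin_word set" where
  "band n i j = gen_desc n (Suc i) j \<otimes>\<^bsub>braid_group n\<^esub> artin_gen n i
     \<otimes>\<^bsub>braid_group n\<^esub> inv\<^bsub>braid_group n\<^esub> gen_desc n (Suc i) j"

text \<open>In a band word, \<open>(True, i, j)\<close> is the positive band \<open>a\<^sub>i\<^sub>j\<close> and \<open>(False, i, j)\<close> the negative one.\<close>

type_synonym band_word = "(bool \<times> nat \<times> nat) list"

definition band_words :: "nat \<Rightarrow> band_word set" where
  "band_words n = lists {(b, i, j). 1 \<le> i \<and> i < j \<and> j \<le> n}"

fun band_letter :: "nat \<Rightarrow> bool \<times> nat \<times> nat \<Rightarrow> artin_word set" where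
  "band_letter n (b, i, j) = (if b then band n i j else inv\<^bsub>braid_group n\<^esub> band n i j)"

definition band_eval :: "nat \<Rightarrow> band_word \<Rightarrow> artin_word set" where
  "band_eval n w = braid_prod n (map (band_letter n) w)"

definition negative_bands :: "band_word \<Rightarrow> nat" where
  "negative_bands w = length (filter (\<lambda>(b, i, j). \<not> b) w)"

definition band_length :: "nat \<Rightarrow> artin_word set \<Rightarrow> nat" where
  "band_length n \<beta> = (LEAST m. \<exists>w\<in>band_words n. band_eval n w = \<beta> \<and> length w = m)"

definition SQP :: "nat \<Rightarrow> artin_word set set" where
  "SQP n = {band_eval n w |w. w \<in> band_words n \<and> negative_bands w = 0}"

definition ASQP :: "nat \<Rightarrow> artin_word set set" where
  "ASQP n = {band_eval n w |w. w \<in> band_words n \<and> negative_bands w \<le> 1}"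


section \<open>Garside structure\<close>

definition braid_le :: "nat \<Rightarrow> artin_word set \<Rightarrow> artin_word set \<Rightarrow> bool" where
  "braid_le n V W \<longleftrightarrow>
     (\<exists>P\<in>SQP n. \<exists>Q\<in>SQP n. W = P \<otimes>\<^bsub>braid_group n\<^esub> V \<otimes>\<^bsub>braid_group n\<^esub> Q)"

definition delta :: "nat \<Rightarrow> artin_word set" where
  "delta n = gen_desc n 1 n"

definition braid_inf :: "nat \<Rightarrow> artin_word set \<Rightarrow> int" where
  "braid_inf n \<beta> = (GREATEST r. braid_le n (delta n [^]\<^bsub>braid_group n\<^esub> r) \<beta>)"

definition braid_sup :: "nat \<Rightarrow> artin_word set \<Rightarrow> int" where
  "braid_sup n \<beta> = (LEAST s. braid_le n \<beta> (delta n [^]\<^bsub>braid_group n\<^esub> s))"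

definition canonical_length :: "nat \<Rightarrow> artin_word set \<Rightarrow> int" where
  "canonical_length n \<beta> = braid_sup n \<beta> - braid_inf n \<beta>"

definition canonical_factors :: "nat \<Rightarrow> artin_word set set" where
  "canonical_factors n = {A \<in> carrier (braid_group n).
     braid_le n \<one>\<^bsub>braid_group n\<^esub> A \<and> braid_le n A (delta n)}"

definition factor_prefix :: "nat \<Rightarrow> artin_word set \<Rightarrow> artin_word set \<Rightarrow> bool" where
  "factor_prefix n A A' \<longleftrightarrow> (\<exists>Q\<in>canonical_factors n. A' = A \<otimes>\<^bsub>braid_group n\<^esub> Q)"

definition left_weighted :: "nat \<Rightarrow> artin_word set \<Rightarrow> artin_word set \<Rightarrow> bool" where
  "left_weighted n A B \<longleftrightarrow>
     \<not> (\<exists>A'\<in>canonical_factors n. \<exists>B'\<in>canonical_factors n.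
          A' \<noteq> A \<and> factor_prefix n A A' \<and>
          A \<otimes>\<^bsub>braid_group n\<^esub> B = A' \<otimes>\<^bsub>braid_group n\<^esub> B')"

text \<open>
  \<open>left_canonical_form n \<beta> r [A\<^sub>1, \<dots>, A\<^sub>k]\<close> says that \<open>\<delta>\<^sup>r A\<^sub>1 \<cdots> A\<^sub>k\<close> is the left-canonical form of \<open>\<beta>\<close>;
  \<open>r\<close> and the list of factors are determined by \<open>\<beta>\<close>.
\<close>

definition left_canonical_form ::
    "nat \<Rightarrow> artin_word set \<Rightarrow> int \<Rightarrow> artin_word set list \<Rightarrow> bool" where
  "left_canonical_form n \<beta> r As \<longleftrightarrow>
     \<beta> = delta n [^]\<^bsub>braid_group n\<^esub> r \<otimes>\<^bsub>braid_group n\<^esub> braid_prod n As \<and>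
     set As \<subseteq> canonical_factors n - {\<one>\<^bsub>braid_group n\<^esub>, delta n} \<and>
     (\<forall>i. Suc i < length As \<longrightarrow> left_weighted n (As ! i) (As ! Suc i))"


section \<open>Conjugacy and super summit sets\<close>

definition conj_class :: "nat \<Rightarrow> artin_word set \<Rightarrow> artin_word set set" where
  "conj_class n \<beta> =
     {g \<otimes>\<^bsub>braid_group n\<^esub> \<beta> \<otimes>\<^bsub>braid_group n\<^esub> inv\<^bsub>braid_group n\<^esub> g |g. g \<in> carrier (braid_group n)}"

definition super_summit_set :: "nat \<Rightarrow> artin_word set \<Rightarrow> artin_word set set" where
  "super_summit_set n \<beta> = {\<beta>' \<in> conj_class n \<beta>.
     \<forall>\<gamma>\<in>conj_class n \<beta>. canonical_length n \<beta>' \<le> canonical_length n \<gamma>}"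

definition conj_SQP :: "nat \<Rightarrow> artin_word set \<Rightarrow> bool" where
  "conj_SQP n \<beta> \<longleftrightarrow> conj_class n \<beta> \<inter> SQP n \<noteq> {}"

definition conj_ASQP :: "nat \<Rightarrow> artin_word set \<Rightarrow> bool" where
  "conj_ASQP n \<beta> \<longleftrightarrow> conj_class n \<beta> \<inter> ASQP n \<noteq> {}"

end

theory Submission
  imports Defs
begin

text \<open>
  \<open>B\<^sub>3\<close> and \<open>B\<^sub>4\<close> are groups of fractions of the dual Garside monoid.  That greedy normal forms of
  positive words are well defined on group elements is shown by letting the braid group act on
  normal forms, up to central powers of \<open>\<delta>\<close>.  The supremum of \<open>\<delta>\<^sup>r P\<close> with \<open>P\<close> positive is \<open>r\<close> plus
  the length of the normal form of \<open>P\<close>.  If some conjugate has larger infimum, iterated cycling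
  reaches one without raising the supremum; applying this also to the inverse, elements of the
  super summit set have both maximal infimum and minimal supremum in their conjugacy class.

  An almost strongly quasipositive braid is conjugate to \<open>\<delta>\<^bsup>-1\<^esup> C Q\<close> with \<open>Q\<close> positive and \<open>C\<close> of
  length \<open>n - 2\<close>, because \<open>a\<^bsup>-1\<^esup> = \<delta>\<^bsup>-1\<^esup> C\<close>, and conversely.  This gives infimum \<open>-1\<close>.  For \<open>n = 4\<close>,
  if all canonical factors of a super summit element were single bands, its supremum would exceed
  that of \<open>\<delta>\<^bsup>-1\<^esup> C Q\<close>, which has the same exponent sum.
\<close>

section \<open>Garside germs and greedy normal forms\<close>

text \<open>A list of factors encodes only a positive element, so an inverse letter cannot act on
  normal forms by itself. Multiplying it by a central power of \<open>top\<close> makes it act, at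
  the price that the relations hold only up to \<open>cen\<close>; as \<open>cen\<close> is
  injective on normal forms, equal braids still yield equal normal forms of positive words. The
  axioms are finite conditions, so for 3 and 4 strands they are settled by evaluation on the 5 and
  14 noncrossing partitions; associativity on words of any length comes from the single condition
  \<open>slide_slide\<close> on triples. The factors that matter are those of rank n - 2:
  \<delta>^-1 times such a factor is an inverse band. For n = 3 every factor other than
  \<open>one\<close> and \<open>top\<close> has this rank; for n = 4 single bands do not. The
  remaining candidate is \<delta>^-1 itself, with infimum -1 and no factors. Its exponent sum is 1 -
  n, while an almost strongly quasipositive braid has exponent sum at least -1. The condition on a
  factor rules it out for n = 4; for n = 3 its conjugacy class is excluded explicitly.\<close>

text \<open>
  \<open>slide s t = (s d, r)\<close> where \<open>t = d r\<close> and \<open>d\<close> is the largest prefix of \<open>t\<close> that \<open>s\<close> can absorb;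
  \<open>lc s\<close> is the left complement of \<open>s\<close>, so that \<open>lc \<circ> lc\<close> is conjugation by \<open>top\<close>.
\<close>

locale germ =
  fixes one top :: 'f
    and mul :: "'f \<Rightarrow> 'f \<Rightarrow> 'f option"
    and slide :: "'f \<Rightarrow> 'f \<Rightarrow> 'f \<times> 'f"
    and lc :: "'f \<Rightarrow> 'f"
    and period :: nat
    and rank :: "'f \<Rightarrow> nat"
  assumes mul_one_left [simp]: "mul one s = Some s"
    and mul_one_right [simp]: "mul s one = Some s"
    and slide_split: "slide s t = (b, r) \<Longrightarrow> \<exists>d. mul s d = Some b \<and> mul d r = Some t"
    and slide_mul: "mul s t = Some p \<Longrightarrow> slide s t = (p, one)"
    and slide_slide: "mul s t = Some p \<Longrightarrow> slide t u = (b, r) \<Longrightarrow> slide s b = (c, q) \<Longrightarrow>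
      \<exists>x. mul q r = Some x \<and> slide p u = (c, x)"
    and slide_top: "slide top t = (top, t)"
    and mul_lc: "mul (lc s) s = Some top"
    and lc_period: "0 < period" "((lc \<circ> lc) ^^ period) s = s"
    and rank_mul: "mul s t = Some p \<Longrightarrow> rank p = rank s + rank t"
    and rank_eq_0: "rank s = 0 \<longleftrightarrow> s = one"
    and top_neq_one: "top \<noteq> one"
begin

section \<open>Left multiplication on normal forms\<close>

fun push :: "'f \<Rightarrow> 'f list \<Rightarrow> 'f list" where
  "push s [] = (if s = one then [] else [s])"
| "push s (a # L) = (case slide s a of (b, r) \<Rightarrow> b # push r L)"

definition nf :: "'f list \<Rightarrow> 'f list" where
  "nf u = foldr push u []"

text \<open>A fixed-point form of greediness: \<open>push\<close> runs through the whole list, so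
  the condition on the head constrains all neighbouring pairs, and it can be handled by
  \<open>push_push\<close> alone.\<close>

definition good :: "'f list \<Rightarrow> bool" where
  "good L \<longleftrightarrow> (\<forall>a L'. L = a # L' \<longrightarrow> push a L' = L)"

definition ptop :: "'f list \<Rightarrow> 'f list" where
  "ptop = push top"

lemma slide_one_right: "slide s one = (s, one)"
  using slide_mul[OF mul_one_right] .

lemma slide_one_left: "slide one s = (s, one)"
  using slide_mul[OF mul_one_left] .

lemma mul_eq_one: "mul s t = Some one \<Longrightarrow> s = one \<and> t = one"
  by (metis rank_mul rank_eq_0 add_eq_0_iff_both_eq_0)

lemma push_one: "push one L = L"
  by (induction L) (auto simp: slide_one_left)

text \<open>\<open>slide_slide\<close> is the induction step: absorbing \<open>a\<close> into
  \<open>p\<close> is absorbing it into \<open>t\<close> and then into \<open>s\<close>, and the two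
  remainders again have a product, which travels on into the tail.\<close>

lemma push_push: "mul s t = Some p \<Longrightarrow> push s (push t L) = push p L"
proof (induction L arbitrary: s t p)
  case Nil
  then show ?case
    using mul_eq_one[of s t] by (auto simp: slide_mul)
next
  case (Cons a L)
  obtain b r where t: "slide t a = (b, r)" by fastforce
  obtain c q where s: "slide s b = (c, q)" by fastforce
  obtain x where "mul q r = Some x" "slide p a = (c, x)"
    using slide_slide[OF Cons.prems t s] by blast
  with Cons.IH[of q r x] show ?case by (simp add: t s)
qed

lemma good_Nil [simp]: "good []"
  by (simp add: good_def)

text \<open>Write \<open>a\<close> as \<open>d r\<close> where \<open>b\<close> is
  \<open>s d\<close>. Moving \<open>d\<close> between the two pushes turns
  \<open>push b (push r M)\<close> into \<open>push s (push a M)\<close>, and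
  \<open>push a M\<close> is the given good list.\<close>

lemma good_push:
  assumes "good L"
  shows "good (push s L)"
proof (cases L)
  case Nil
  then show ?thesis by (auto simp: good_def)
next
  case (Cons a M)
  obtain b r where s: "slide s a = (b, r)" by fastforce
  obtain d where d: "mul s d = Some b" "mul d r = Some a"
    using slide_split[OF s] by blast
  have "push b (push r M) = push s (push a M)"
    using push_push[OF d(1)] push_push[OF d(2)] by metis
  with assms show ?thesis by (auto simp: good_def Cons s)
qed

lemma good_nf: "good (nf u)"
  by (induction u) (auto simp: nf_def good_push)

text \<open>\<open>top\<close> absorbs nothing, so the head is passed on unchanged and goodness
  rebuilds the list behind \<open>top\<close>. This left inverse of \<open>ptop\<close> is the
  source of every cancellation below.\<close>

lemma tl_ptop: "good L \<Longrightarrow> tl (ptop L) = L"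
  by (cases L) (auto simp: good_def ptop_def slide_top top_neq_one)

lemma hd_ptop: "ptop L \<noteq> [] \<and> hd (ptop L) = top"
  by (cases L) (auto simp: ptop_def slide_top top_neq_one)

lemma lc_pow: "\<exists>t. (lc \<circ> lc) t = s"
  using lc_period(2)[of s] lc_period(1) by (cases period) auto

text \<open>Only left complements are given; since \<open>lc \<circ> lc\<close> has finite order,
  \<open>lc\<close> is onto and right complements exist too.\<close>

lemma mul_rc: "\<exists>t. lc t = s \<and> mul s t = Some top"
  using lc_pow[of s] mul_lc by auto

text \<open>Both sides push the three factors \<open>lc (lc s)\<close>, \<open>lc s\<close>,
  \<open>s\<close>, bracketed in the two possible ways.\<close>

lemma ptop_push: "ptop (push s L) = push (lc (lc s)) (ptop L)"
  using push_push[OF mul_lc[of "lc s"]] push_push[OF mul_lc[of s]] by (metis ptop_def)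

lemma ptop_pow_push: "(ptop ^^ k) (push s L) = push (((lc \<circ> lc) ^^ k) s) ((ptop ^^ k) L)"
  by (induction k) (auto simp: ptop_push)

text \<open>The power \<open>top\<^bsup>period\<^esup>\<close> is central.\<close>

definition cen :: "'f list \<Rightarrow> 'f list" where
  "cen = ptop ^^ period"

lemma cen_push: "cen (push s L) = push s (cen L)"
  by (simp add: cen_def ptop_pow_push lc_period)

lemma good_ptop_pow: "good L \<Longrightarrow> good ((ptop ^^ k) L)"
  by (induction k) (auto simp: ptop_def good_push)

lemma cen_pow: "(cen ^^ k) L = (ptop ^^ (period * k)) L"
  by (simp add: cen_def funpow_mult mult.commute)

lemma good_cen_pow: "good L \<Longrightarrow> good ((cen ^^ k) L)"
  by (simp add: cen_pow good_ptop_pow)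

lemma ptop_pow_inj: "good L \<Longrightarrow> good M \<Longrightarrow> (ptop ^^ k) L = (ptop ^^ k) M \<Longrightarrow> L = M"
proof (induction k)
  case (Suc k)
  then have "tl (ptop ((ptop ^^ k) L)) = tl (ptop ((ptop ^^ k) M))"
    by simp
  with Suc show ?case
    using tl_ptop[OF good_ptop_pow] by metis
qed simp

lemma cen_pow_inj: "good L \<Longrightarrow> good M \<Longrightarrow> (cen ^^ k) L = (cen ^^ k) M \<Longrightarrow> L = M"
  by (simp add: cen_pow ptop_pow_inj)

lemma cen_pow_push: "(cen ^^ k) (push s L) = push s ((cen ^^ k) L)"
  by (induction k) (auto simp: cen_push)

text \<open>Pushing \<open>lc s\<close> completes \<open>s\<close> to \<open>top\<close>, which can
  be cancelled.\<close>

lemma push_inj: "good L \<Longrightarrow> good M \<Longrightarrow> push s L = push s M \<Longrightarrow> L = M"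
  using push_push[OF mul_lc] tl_ptop by (metis ptop_def)

lemma length_push: "length L \<le> length (push s L)" "length (push s L) \<le> Suc (length L)"
  by (induction L arbitrary: s) (auto split: prod.split)

lemma length_nf: "length (nf u) \<le> length u"
proof (induction u)
  case (Cons s u)
  then show ?case using length_push(2)[of s "nf u"] by (simp add: nf_def)
qed (simp add: nf_def)

lemma length_foldr_push: "length L \<le> length (foldr push u L)"
  by (induction u) (auto intro: order_trans length_push(1))

lemma nf_top_power: "nf (replicate k top) = replicate k top"
proof -
  have "push top (replicate k top) = replicate (Suc k) top" for k
    by (induction k) (auto simp: slide_top top_neq_one)
  then show ?thesis by (induction k) (auto simp: nf_def)
qed

lemma one_notin_push: "one \<notin> set L \<Longrightarrow> one \<notin> set (push s L)"
proof (induction L arbitrary: s)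
  case (Cons a L)
  obtain b r where s: "slide s a = (b, r)" by fastforce
  have "b \<noteq> one"
    using slide_split[OF s] mul_eq_one Cons.prems slide_one_left s by fastforce
  with Cons show ?case by (auto simp: s)
qed auto

lemma one_notin_nf: "one \<notin> set (nf u)"
  by (induction u) (auto simp: nf_def one_notin_push)

text \<open>The greatest prefix of \<open>s L\<close> below \<open>top\<close> depends only on \<open>s\<close> and the head of \<open>L\<close>.\<close>

definition head :: "'f list \<Rightarrow> 'f" where
  "head L = (if L = [] then one else hd L)"

lemma head_push: "head (push s L) = fst (slide s (head L))"
  by (cases L) (auto simp: head_def slide_one_right split: prod.split)

lemma slide_fixed: "slide a b = (a, r) \<Longrightarrow> r = b"
proof -
  assume s: "slide a b = (a, r)"
  then obtain d where d: "mul a d = Some a" "mul d r = Some b"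
    using slide_split by blast
  then have "d = one"
    using rank_mul rank_eq_0 by force
  with d(2) show "r = b" by simp
qed

text \<open>Makes \<open>good_nf\<close> available for tails, since \<open>good\<close> mentions
  only the head; the tail is the normal form of the remainder followed by the old tail.\<close>

lemma tl_nf: "\<exists>v. tl (nf u) = nf v"
proof (induction u)
  case Nil
  have "tl (nf []) = nf []" by (simp add: nf_def)
  then show ?case by blast
next
  case (Cons s u)
  then obtain v where v: "tl (nf u) = nf v" by blast
  show ?case
  proof (cases "nf u")
    case Nil
    then have "tl (nf (s # u)) = nf []"
      by (simp add: nf_def)
    then show ?thesis by blast
  next
    case (Cons a L)
    then have "tl (nf (s # u)) = nf (snd (slide s a) # v)"
      using v by (simp add: nf_def split: prod.split)
    then show ?thesis by blast
  qed
qed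

lemma nf_greedy:
  assumes "Suc i < length (nf u)"
  shows "slide (nf u ! i) (nf u ! Suc i) = (nf u ! i, nf u ! Suc i)"
  using assms
proof (induction i arbitrary: u)
  case 0
  then obtain a b L where L: "nf u = a # b # L"
    by (metis One_nat_def list.size(3,4) neq_Nil_conv not_less0 less_Suc_eq add_0 add.right_neutral add_Suc_right)
  then have "push a (b # L) = a # b # L"
    using good_nf[of u] by (auto simp: good_def)
  moreover obtain v where "b # L = nf v"
    using tl_nf[of u] L by auto
  then have "push b L = b # L"
    using good_nf[of v] unfolding good_def by metis
  ultimately show ?case using L slide_fixed by (auto split: prod.splits)
next
  case (Suc i)
  obtain v where v: "tl (nf u) = nf v"
    using tl_nf by blast
  with Suc.prems have "Suc i < length (nf v)" "nf u = hd (nf u) # nf v"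
    by (cases "nf u"; force)+
  with Suc.IH[of v] show ?case by (metis nth_Cons_Suc)
qed

end

section \<open>Groups of fractions of a germ\<close>

text \<open>The deep assumption is \<open>nf_unique\<close>: the monoid defined by the germ embeds
  in the group. For braid groups it is discharged by \<open>nf_faithful\<close>.\<close>

locale garside_group = germ one top mul slide lc period rank + group G
  for one top :: 'f and mul slide lc period rank and G (structure) +
  fixes ev :: "'f \<Rightarrow> 'a"
    and deg :: "'a \<Rightarrow> int"
  assumes ev_closed [simp]: "ev s \<in> carrier G"
    and ev_one [simp]: "ev one = \<one>"
    and ev_mul: "mul s t = Some p \<Longrightarrow> ev s \<otimes> ev t = ev p"
    and deg_mult: "x \<in> carrier G \<Longrightarrow> y \<in> carrier G \<Longrightarrow> deg (x \<otimes> y) = deg x + deg y"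
    and deg_ev: "deg (ev s) = int (rank s)"
    and nf_unique: "foldr (\<lambda>s x. ev s \<otimes> x) u \<one> = foldr (\<lambda>s x. ev s \<otimes> x) v \<one> \<Longrightarrow> nf u = nf v"
    and generated: "\<one> \<in> S \<Longrightarrow> (\<And>s x. x \<in> S \<Longrightarrow> ev s \<otimes> x \<in> S) \<Longrightarrow>
      (\<And>s x. x \<in> S \<Longrightarrow> inv (ev s) \<otimes> x \<in> S) \<Longrightarrow> carrier G \<subseteq> S"
begin

abbreviation \<delta> where "\<delta> \<equiv> ev top"

definition eval :: "'f list \<Rightarrow> 'a" where
  "eval u = foldr (\<lambda>s x. ev s \<otimes> x) u \<one>"

definition Pos :: "'a set" where
  "Pos = range eval"

definition prods :: "nat \<Rightarrow> 'a set" where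
  "prods k = {eval u |u. length u \<le> k}"

definition twist :: "int \<Rightarrow> 'a \<Rightarrow> 'a" where
  "twist r x = \<delta> [^] r \<otimes> x \<otimes> \<delta> [^] (- r)"

lemma eval_Nil [simp]: "eval [] = \<one>"
  and eval_Cons [simp]: "eval (s # u) = ev s \<otimes> eval u"
  by (simp_all add: eval_def)

lemma eval_closed [simp]: "eval u \<in> carrier G"
  by (induction u) auto

lemma eval_append: "eval (u @ v) = eval u \<otimes> eval v"
  by (induction u) (auto simp: m_assoc)

lemma eval_push: "eval (push s L) = ev s \<otimes> eval L"
proof (induction L arbitrary: s)
  case (Cons a L)
  obtain b r where s: "slide s a = (b, r)" by fastforce
  obtain d where d: "mul s d = Some b" "mul d r = Some a"
    using slide_split[OF s] by blast
  have "ev b \<otimes> (ev r \<otimes> eval L) = ev s \<otimes> (ev a \<otimes> eval L)"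
    by (simp add: m_assoc flip: ev_mul[OF d(1)] ev_mul[OF d(2)])
  then show ?case by (simp add: s Cons.IH)
qed auto

lemma eval_nf: "eval (nf u) = eval u"
  by (induction u) (auto simp: nf_def eval_push)

lemma nf_cong: "eval u = eval v \<Longrightarrow> nf u = nf v"
  by (rule nf_unique) (simp add: eval_def)

lemma prods_Pos: "x \<in> prods k \<Longrightarrow> x \<in> Pos"
  by (auto simp: prods_def Pos_def)

lemma Pos_closed: "x \<in> Pos \<Longrightarrow> x \<in> carrier G"
  by (auto simp: Pos_def)

lemma one_Pos: "\<one> \<in> Pos"
  unfolding Pos_def by (metis eval_Nil rangeI)

lemma ev_Pos: "ev s \<in> Pos"
proof -
  have "ev s = eval [s]" by simp
  then show ?thesis unfolding Pos_def by blast
qed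

lemma Pos_mult: "x \<in> Pos \<Longrightarrow> y \<in> Pos \<Longrightarrow> x \<otimes> y \<in> Pos"
  by (auto simp: Pos_def simp flip: eval_append)

lemma prods_mult:
  assumes "x \<in> prods j" "y \<in> prods k"
  shows "x \<otimes> y \<in> prods (j + k)"
proof -
  obtain u v where "x = eval u" "length u \<le> j" "y = eval v" "length v \<le> k"
    using assms by (auto simp: prods_def)
  then have "x \<otimes> y = eval (u @ v)" "length (u @ v) \<le> j + k"
    by (simp_all add: eval_append)
  then show ?thesis unfolding prods_def by blast
qed

lemma ev_prods: "ev s \<in> prods (Suc 0)"
proof -
  have "ev s = eval [s]" by simp
  then show ?thesis unfolding prods_def by (intro CollectI exI[of _ "[s]"]) simp
qed

text \<open>Normal forms are shortest: \<open>nf\<close> never lengthens a word and depends only on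
  its value.\<close>

lemma eval_in_prods: "eval u \<in> prods k \<longleftrightarrow> length (nf u) \<le> k"
proof
  assume "eval u \<in> prods k"
  then obtain v where "eval u = eval v" "length v \<le> k"
    by (auto simp: prods_def)
  then show "length (nf u) \<le> k"
    using nf_cong[of u v] length_nf[of v] by simp
next
  assume "length (nf u) \<le> k"
  then show "eval u \<in> prods k"
    unfolding prods_def using eval_nf[of u] by (metis (mono_tags, lifting) mem_Collect_eq)
qed

lemma ev_inj: "ev s = ev t \<Longrightarrow> s = t"
  using nf_cong[of "[s]" "[t]"] by (auto simp: nf_def split: if_splits)

subsection \<open>Conjugation by powers of \<open>\<delta>\<close>\<close>

lemma dpow_mult: "\<delta> [^] (r + s :: int) = \<delta> [^] r \<otimes> \<delta> [^] s"
  by (simp add: int_pow_mult)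

lemma dpow_cancel [simp]:
  "\<delta> [^] (- r :: int) \<otimes> \<delta> [^] r = \<one>" "\<delta> [^] r \<otimes> \<delta> [^] (- r :: int) = \<one>"
  by (simp_all flip: dpow_mult)

lemma dpow_cancel2:
  assumes "x \<in> carrier G"
  shows "\<delta> [^] (- r :: int) \<otimes> (\<delta> [^] r \<otimes> x) = x" "\<delta> [^] r \<otimes> (\<delta> [^] (- r :: int) \<otimes> x) = x"
  using assms by (simp_all flip: m_assoc)

lemma twist_closed [simp]: "x \<in> carrier G \<Longrightarrow> twist r x \<in> carrier G"
  by (simp add: twist_def)

lemma twist_mult:
  "x \<in> carrier G \<Longrightarrow> y \<in> carrier G \<Longrightarrow> twist r (x \<otimes> y) = twist r x \<otimes> twist r y"
  by (simp add: twist_def m_assoc dpow_cancel2)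

lemma twist_one: "twist r \<one> = \<one>"
  by (simp add: twist_def)

lemma twist_twist: "x \<in> carrier G \<Longrightarrow> twist r (twist s x) = twist (r + s) x"
  using dpow_mult[of r s] dpow_mult[of "- s" "- r"]
  by (simp add: twist_def m_assoc minus_diff_commute)

lemma twist_0: "x \<in> carrier G \<Longrightarrow> twist 0 x = x"
  by (simp add: twist_def)

lemma twist_inverse: "x \<in> carrier G \<Longrightarrow> twist (- r) (twist r x) = x"
  by (simp add: twist_twist twist_0)

lemma twist_inverse': "x \<in> carrier G \<Longrightarrow> twist r (twist (- r) x) = x"
  by (simp add: twist_twist twist_0)

lemma twist_dpow: "twist r (\<delta> [^] (s::int)) = \<delta> [^] s"
  by (simp add: twist_def flip: dpow_mult)

lemma twist_1_ev: "twist 1 (ev s) = ev (lc (lc s))"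
proof -
  have "\<delta> \<otimes> ev s = ev (lc (lc s)) \<otimes> \<delta>"
    using ev_mul[OF mul_lc[of s]] ev_mul[OF mul_lc[of "lc s"]] by (metis ev_closed m_assoc)
  then have "twist 1 (ev s) = ev (lc (lc s)) \<otimes> (\<delta> \<otimes> \<delta> [^] (- 1 :: int))"
    by (simp add: twist_def m_assoc)
  also have "\<delta> \<otimes> \<delta> [^] (- 1 :: int) = \<one>"
    using dpow_cancel(2)[of 1] by simp
  finally show ?thesis by simp
qed

lemma twist_ev: "\<exists>t. twist r (ev s) = ev t"
proof (induction r arbitrary: s rule: int_induct[where k = 0])
  case base
  then show ?case by (auto simp: twist_0)
next
  case (step1 r)
  have "twist (r + 1) (ev s) = twist r (ev (lc (lc s)))"
    by (simp add: twist_twist flip: twist_1_ev)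
  with step1.IH show ?case by simp
next
  case (step2 r)
  obtain t where t: "(lc \<circ> lc) t = s"
    using lc_pow by blast
  have "twist (r - 1) (ev s) = twist r (ev t)"
    by (simp add: twist_twist flip: t twist_1_ev)
  with step2.IH show ?case by simp
qed

lemma twist_eval: "\<exists>v. twist r (eval u) = eval v \<and> length v = length u"
proof (induction u)
  case (Cons s u)
  obtain v where "twist r (eval u) = eval v" "length v = length u"
    using Cons by blast
  moreover obtain t where "twist r (ev s) = ev t"
    using twist_ev by blast
  ultimately have "twist r (eval (s # u)) = eval (t # v) \<and> length (t # v) = length (s # u)"
    by (simp add: twist_mult)
  then show ?case by blast
qed (simp add: twist_one)

lemma twist_Pos: "x \<in> Pos \<Longrightarrow> twist r x \<in> Pos"
  using twist_eval by (fastforce simp: Pos_def)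

lemma twist_prods: "x \<in> prods k \<Longrightarrow> twist r x \<in> prods k"
  using twist_eval unfolding prods_def by clarsimp metis

text \<open>An inverse factor equals \<delta>^-1 times a left complement, so one more power of
  \<delta> clears it; a power of \<delta> passes a factor at the cost of a twist.\<close>

lemma fractions:
  assumes "g \<in> carrier G"
  shows "\<exists>r. \<delta> [^] (r::int) \<otimes> g \<in> Pos"
proof -
  let ?S = "{g \<in> carrier G. \<exists>r. \<delta> [^] (r::int) \<otimes> g \<in> Pos}"
  have "carrier G \<subseteq> ?S"
  proof (rule generated)
    have "\<delta> [^] (0::int) \<otimes> \<one> \<in> Pos"
      using one_Pos by simp
    then show "\<one> \<in> ?S" by blast
  next
    fix s x assume "x \<in> ?S"
    then obtain r where r: "x \<in> carrier G" "\<delta> [^] (r::int) \<otimes> x \<in> Pos" by blast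
    have "\<delta> [^] r \<otimes> (ev s \<otimes> x) = twist r (ev s) \<otimes> (\<delta> [^] r \<otimes> x)"
      using r(1) by (simp add: twist_def m_assoc dpow_cancel2)
    then have "\<delta> [^] r \<otimes> (ev s \<otimes> x) \<in> Pos"
      using r(2) by (simp add: Pos_mult twist_Pos ev_Pos)
    then show "ev s \<otimes> x \<in> ?S" using r(1) by auto
  next
    fix s x assume "x \<in> ?S"
    then obtain r where r: "x \<in> carrier G" "\<delta> [^] (r::int) \<otimes> x \<in> Pos" by blast
    have "\<delta> \<otimes> inv (ev s) = ev (lc s)"
      using ev_mul[OF mul_lc[of s]] by (metis inv_solve_right ev_closed)
    then have "\<delta> [^] (r + 1) \<otimes> (inv (ev s) \<otimes> x) = \<delta> [^] r \<otimes> (ev (lc s) \<otimes> x)"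
      using r(1) by (simp add: dpow_mult m_assoc) (simp flip: m_assoc)
    also have "\<dots> = twist r (ev (lc s)) \<otimes> (\<delta> [^] r \<otimes> x)"
      using r(1) by (simp add: twist_def m_assoc dpow_cancel2)
    finally have "\<delta> [^] (r + 1) \<otimes> (inv (ev s) \<otimes> x) \<in> Pos"
      using r(2) by (simp add: Pos_mult twist_Pos ev_Pos)
    then show "inv (ev s) \<otimes> x \<in> ?S" using r(1) by auto
  qed
  with assms show ?thesis by blast
qed

lemma deg_one: "deg \<one> = 0"
  using deg_mult[of \<one> \<one>] by simp

lemma deg_inv: "x \<in> carrier G \<Longrightarrow> deg (inv x) = - deg x"
  using deg_mult[of x "inv x"] deg_one by simp

lemma deg_natpow: "x \<in> carrier G \<Longrightarrow> deg (x [^] (k::nat)) = int k * deg x"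
  by (induction k) (auto simp: deg_one deg_mult algebra_simps)

lemma deg_dpow: "deg (\<delta> [^] (r::int)) = r * deg \<delta>"
  by (cases r rule: int_cases2) (simp_all add: deg_natpow deg_inv int_pow_neg int_pow_int)

lemma deg_\<delta>: "0 < deg \<delta>"
  using deg_ev[of top] rank_eq_0[of top] top_neq_one by auto

lemma deg_twist: "x \<in> carrier G \<Longrightarrow> deg (twist r x) = deg x"
  by (simp add: twist_def deg_mult deg_dpow)

lemma deg_eval: "deg (eval u) = int (\<Sum>s\<leftarrow>u. rank s)"
  by (induction u) (auto simp: deg_one deg_mult deg_ev)

lemma deg_Pos: "x \<in> Pos \<Longrightarrow> 0 \<le> deg x"
  by (auto simp: Pos_def deg_eval)

subsection \<open>Divisors of powers of \<open>\<delta>\<close>\<close>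

lemma eval_top_power: "eval (replicate k top) = \<delta> [^] int k"
proof (induction k)
  case (Suc k)
  have "int (Suc k) = 1 + int k" by simp
  then show ?case using Suc by (metis dpow_mult eval_Cons int_pow_1 ev_closed replicate_Suc)
qed simp

lemma dpow_Pos: "0 \<le> r \<Longrightarrow> \<delta> [^] (r::int) \<in> Pos"
  using eval_top_power[of "nat r"] unfolding Pos_def by (metis rangeI int_nat_eq)

text \<open>The word of k letters \<open>top\<close> is its own normal form, and pushing further
  factors never shortens the normal form of a suffix.\<close>

lemma suffix_dpow:
  assumes "U \<in> Pos" "P \<in> Pos" "U \<otimes> P = \<delta> [^] int k"
  shows "P \<in> prods k"
proof -
  obtain u v where uv: "U = eval u" "P = eval v"
    using assms by (auto simp: Pos_def)
  then have "eval (u @ v) = eval (replicate k top)"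
    using assms by (simp add: eval_append eval_top_power)
  then have "nf (u @ v) = replicate k top"
    using nf_cong nf_top_power by metis
  then have "length (nf v) \<le> k"
    using length_foldr_push[of "nf v" u] by (simp add: nf_def)
  then show ?thesis by (simp add: uv eval_in_prods)
qed

text \<open>Reduces to a suffix: \<delta>^k lets \<open>V\<close> be carried from the right end to
  the left end as a twist.\<close>

lemma factor_dpow:
  assumes "U \<in> Pos" "P \<in> Pos" "V \<in> Pos" "U \<otimes> P \<otimes> V = \<delta> [^] int k"
  shows "P \<in> prods k"
proof (rule suffix_dpow)
  note [simp] = Pos_closed[OF assms(1)] Pos_closed[OF assms(2)] Pos_closed[OF assms(3)]
  show "twist (int k) V \<otimes> U \<in> Pos"
    by (intro Pos_mult twist_Pos assms)
  have "U \<otimes> P = \<delta> [^] int k \<otimes> inv V"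
    using assms(4) by (metis Pos_closed assms(1-3) inv_solve_right m_closed int_pow_closed ev_closed)
  then have "twist (int k) V \<otimes> (U \<otimes> P) = \<delta> [^] int k \<otimes> V \<otimes> (\<delta> [^] (- int k) \<otimes> \<delta> [^] int k) \<otimes> inv V"
    by (simp add: twist_def m_assoc dpow_cancel2)
  then show "twist (int k) V \<otimes> U \<otimes> P = \<delta> [^] int k"
    by (simp add: m_assoc)
qed (use assms in auto)

text \<open>Each new factor contributes its right complement, which has to cross the power of
  \<delta> built so far and is twisted by it.\<close>

lemma eval_complement: "\<exists>Q\<in>Pos. eval u \<otimes> Q = \<delta> [^] int (length u)"
proof (induction u)
  case Nil
  show ?case using one_Pos by (auto intro!: bexI[of _ "\<one>"])
next
  case (Cons s u)
  then obtain Q where Q: "Q \<in> Pos" "eval u \<otimes> Q = \<delta> [^] int (length u)" by blast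
  obtain t where t: "mul s t = Some top"
    using mul_rc by blast
  have [simp]: "Q \<in> carrier G" using Q Pos_closed by auto
  have "eval (s # u) \<otimes> (Q \<otimes> twist (- int (length u)) (ev t)) =
      ev s \<otimes> (eval u \<otimes> Q \<otimes> twist (- int (length u)) (ev t))"
    by (simp add: m_assoc)
  also have "\<dots> = ev s \<otimes> (ev t \<otimes> \<delta> [^] int (length u))"
    unfolding Q(2) by (simp add: twist_def flip: m_assoc)
  also have "\<dots> = \<delta> \<otimes> \<delta> [^] int (length u)"
    using ev_mul[OF t] by (simp flip: m_assoc)
  also have "\<dots> = \<delta> [^] int (length (s # u))"
    using dpow_mult[of 1] by simp
  finally show ?case
    using Pos_mult[OF Q(1) twist_Pos[OF ev_Pos]] by blast
qed

lemma prods_complement: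
  assumes "P \<in> prods k"
  shows "\<exists>Q\<in>Pos. P \<otimes> Q = \<delta> [^] int k"
proof -
  obtain u where u: "P = eval u" "length u \<le> k"
    using assms by (auto simp: prods_def)
  obtain Q where Q: "Q \<in> Pos" "eval u \<otimes> Q = \<delta> [^] int (length u)"
    using eval_complement by blast
  have "eval u \<otimes> (Q \<otimes> \<delta> [^] (int k - int (length u))) = \<delta> [^] int k"
    using Q Pos_closed[OF Q(1)] dpow_mult[of "int (length u)" "int k - int (length u)"]
    by (simp flip: m_assoc)
  moreover have "Q \<otimes> \<delta> [^] (int k - int (length u)) \<in> Pos"
    using Q(1) u(2) by (intro Pos_mult dpow_Pos) auto
  ultimately show ?thesis using u(1) by blast
qed

subsection \<open>Infimum and supremum\<close>

definition le :: "'a \<Rightarrow> 'a \<Rightarrow> bool" where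
  "le V W \<longleftrightarrow> (\<exists>P\<in>Pos. \<exists>Q\<in>Pos. W = P \<otimes> V \<otimes> Q)"

definition Inf :: "'a \<Rightarrow> int" where
  "Inf g = (GREATEST r. le (\<delta> [^] r) g)"

definition Sup :: "'a \<Rightarrow> int" where
  "Sup g = (LEAST s. le g (\<delta> [^] s))"

lemma le_inv:
  assumes "V \<in> carrier G" "W \<in> carrier G" "le V W"
  shows "le (inv W) (inv V)"
proof -
  obtain P Q where PQ: "P \<in> Pos" "Q \<in> Pos" "W = P \<otimes> V \<otimes> Q"
    using assms by (auto simp: le_def)
  note [simp] = Pos_closed[OF PQ(1)] Pos_closed[OF PQ(2)]
  have "Q \<otimes> inv W \<otimes> P = inv V"
    using assms(1) by (simp add: PQ(3) inv_mult_group m_assoc) (simp flip: m_assoc)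
  then show ?thesis using PQ unfolding le_def by metis
qed

lemma le_inv_dpow: "g \<in> carrier G \<Longrightarrow> le (\<delta> [^] r) (inv g) \<longleftrightarrow> le g (\<delta> [^] (- r :: int))"
  using le_inv[of "\<delta> [^] r" "inv g"] le_inv[of g "\<delta> [^] (- r)"]
  by (auto simp: int_pow_neg)

text \<open>Powers of \<delta> normalize \<open>Pos\<close>, so the two-sided order becomes
  one-sided divisibility.\<close>

lemma le_dpow:
  assumes g: "g \<in> carrier G"
  shows "le (\<delta> [^] r) g \<longleftrightarrow> \<delta> [^] (- r :: int) \<otimes> g \<in> Pos"
proof
  assume "le (\<delta> [^] r) g"
  then obtain P Q where PQ: "P \<in> Pos" "Q \<in> Pos" "g = P \<otimes> \<delta> [^] r \<otimes> Q"
    by (auto simp: le_def)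
  note [simp] = Pos_closed[OF PQ(1)] Pos_closed[OF PQ(2)]
  have "\<delta> [^] (- r) \<otimes> g = twist (- r) P \<otimes> Q"
    by (simp add: PQ(3) twist_def m_assoc)
  then show "\<delta> [^] (- r) \<otimes> g \<in> Pos"
    using PQ by (simp add: Pos_mult twist_Pos)
next
  assume "\<delta> [^] (- r) \<otimes> g \<in> Pos"
  moreover have "g = \<one> \<otimes> \<delta> [^] r \<otimes> (\<delta> [^] (- r) \<otimes> g)"
    using g by (simp add: dpow_cancel2)
  ultimately show "le (\<delta> [^] r) g"
    using one_Pos unfolding le_def by blast
qed

lemma Pos_dpow_mono:
  assumes "g \<in> carrier G" "\<delta> [^] (- s :: int) \<otimes> g \<in> Pos" "r \<le> s"
  shows "\<delta> [^] (- r :: int) \<otimes> g \<in> Pos"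
proof -
  have "\<delta> [^] (- r) \<otimes> g = \<delta> [^] (s - r) \<otimes> (\<delta> [^] (- s) \<otimes> g)"
    using assms(1) by (simp flip: m_assoc dpow_mult)
  then show ?thesis using assms by (simp add: Pos_mult dpow_Pos)
qed

text \<open>Makes the \<open>GREATEST\<close> in \<open>Inf\<close> meaningful:
  \<open>fractions\<close> supplies some exponent and the degree bounds all of them.\<close>

lemma Inf_iff:
  assumes g: "g \<in> carrier G"
  shows "\<delta> [^] (- r :: int) \<otimes> g \<in> Pos \<longleftrightarrow> r \<le> Inf g"
proof -
  let ?P = "\<lambda>r::int. \<delta> [^] (- r) \<otimes> g \<in> Pos"
  obtain r0 where "\<delta> [^] (r0::int) \<otimes> g \<in> Pos"
    using fractions[OF g] by blast
  then have r0: "?P (- r0)" by simp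
  \<comment> \<open>A positive element has nonnegative degree, so s times deg \<delta> is at most
    deg g, and deg \<delta> is at least 1.\<close>
  have bound: "s \<le> max 0 (deg g)" if "?P s" for s
  proof (rule ccontr)
    assume "\<not> s \<le> max 0 (deg g)"
    moreover have "s * deg \<delta> \<le> deg g"
      using deg_Pos[OF that] g by (simp add: deg_mult deg_dpow)
    ultimately show False
      using deg_\<delta> by (smt (verit) mult_le_cancel_left1)
  qed
  \<comment> \<open>Exponents are shifted by \<open>r0\<close> so that the maximum is taken over
    natural numbers.\<close>
  define k where "k = (GREATEST k::nat. ?P (int k - r0))"
  have b: "j \<le> nat (max 0 (deg g) + r0)" if "?P (int j - r0)" for j
    using bound[OF that] by simp
  have r0': "?P (int 0 - r0)" using r0 by simp
  have k: "?P (int k - r0)"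
    unfolding k_def by (rule GreatestI_nat[where P = "\<lambda>k. ?P (int k - r0)", OF r0' b])
  have max: "j \<le> k" if "?P (int j - r0)" for j
    unfolding k_def by (rule Greatest_le_nat[where P = "\<lambda>k. ?P (int k - r0)", OF that b])
  have le: "s \<le> int k - r0" if "?P s" for s
  proof (cases "- r0 \<le> s")
    case True
    then show ?thesis using max[of "nat (s + r0)"] that by simp
  qed simp
  have "Inf g = int k - r0"
    unfolding Inf_def le_dpow[OF g] by (rule Greatest_equality) (use k le in auto)
  then show ?thesis using le Pos_dpow_mono[OF g k, of r] by auto
qed

lemma le_dpow_iff: "g \<in> carrier G \<Longrightarrow> le (\<delta> [^] r) g \<longleftrightarrow> r \<le> Inf g"
  by (simp add: le_dpow Inf_iff)

lemma Inf_obtain: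
  assumes "g \<in> carrier G"
  obtains P where "P \<in> Pos" "g = \<delta> [^] Inf g \<otimes> P"
proof -
  have "\<delta> [^] (- Inf g) \<otimes> g \<in> Pos" using Inf_iff[OF assms] by blast
  moreover have "g = \<delta> [^] Inf g \<otimes> (\<delta> [^] (- Inf g) \<otimes> g)"
    using assms by (simp add: dpow_cancel2)
  ultimately show ?thesis using that by blast
qed

lemma Inf_ge: "P \<in> Pos \<Longrightarrow> r \<le> Inf (\<delta> [^] r \<otimes> P)"
  using Inf_iff[of "\<delta> [^] r \<otimes> P" r] Pos_closed[of P] by (simp add: dpow_cancel2)

lemma dpow_in_Pos: "\<delta> [^] (r::int) \<in> Pos \<Longrightarrow> 0 \<le> r"
  using deg_Pos[of "\<delta> [^] r"] deg_\<delta> by (auto simp: deg_dpow zero_le_mult_iff)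

text \<open>After cancelling \<delta>^r this asks which positive elements are factors of a power of
  \<delta>: \<open>factor_dpow\<close> bounds their length and \<open>prods_complement\<close> shows
  that the bound suffices.\<close>

lemma le_dpow_right:
  assumes P: "P \<in> Pos"
  shows "le (\<delta> [^] r \<otimes> P) (\<delta> [^] (s::int)) \<longleftrightarrow> r \<le> s \<and> P \<in> prods (nat (s - r))"
proof
  note [simp] = Pos_closed[OF P]
  assume "le (\<delta> [^] r \<otimes> P) (\<delta> [^] s)"
  then obtain U V where UV: "U \<in> Pos" "V \<in> Pos" "\<delta> [^] s = U \<otimes> (\<delta> [^] r \<otimes> P) \<otimes> V"
    by (auto simp: le_def)
  note [simp] = Pos_closed[OF UV(1)] Pos_closed[OF UV(2)]
  have "\<delta> [^] (s - r) = \<delta> [^] (- r) \<otimes> \<delta> [^] s"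
    by (simp flip: dpow_mult)
  also have "\<dots> = twist (- r) U \<otimes> P \<otimes> V"
    by (simp add: UV(3) twist_def m_assoc)
  finally have eq: "twist (- r) U \<otimes> P \<otimes> V = \<delta> [^] (s - r)" ..
  moreover have "twist (- r) U \<otimes> P \<otimes> V \<in> Pos"
    using UV P by (intro Pos_mult twist_Pos)
  ultimately have "0 \<le> s - r" using dpow_in_Pos by metis
  then show "r \<le> s \<and> P \<in> prods (nat (s - r))"
    using factor_dpow[OF twist_Pos[OF UV(1)] P UV(2)] eq by simp
next
  note [simp] = Pos_closed[OF P]
  assume "r \<le> s \<and> P \<in> prods (nat (s - r))"
  then obtain Q where Q: "Q \<in> Pos" "P \<otimes> Q = \<delta> [^] (s - r)"
    using prods_complement by fastforce
  then have "\<delta> [^] s = \<one> \<otimes> (\<delta> [^] r \<otimes> P) \<otimes> Q"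
    using Pos_closed[OF Q(1)] by (simp add: m_assoc flip: dpow_mult)
  then show "le (\<delta> [^] r \<otimes> P) (\<delta> [^] s)"
    using Q(1) one_Pos unfolding le_def by blast
qed

lemma Sup_eval: "Sup (\<delta> [^] (r::int) \<otimes> eval u) = r + int (length (nf u))"
proof -
  have "le (\<delta> [^] r \<otimes> eval u) (\<delta> [^] s) \<longleftrightarrow> r + int (length (nf u)) \<le> s" for s
    by (subst le_dpow_right) (auto simp: eval_in_prods Pos_def)
  then show ?thesis unfolding Sup_def by (intro Least_equality) auto
qed

lemma Sup_le: "P \<in> prods k \<Longrightarrow> Sup (\<delta> [^] (r::int) \<otimes> P) \<le> r + int k"
  by (auto simp: prods_def Sup_eval intro!: order_trans[OF length_nf])

lemma Sup_prods:
  assumes "P \<in> Pos"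
  shows "\<exists>k. Sup (\<delta> [^] (r::int) \<otimes> P) = r + int k \<and> P \<in> prods k"
  using assms eval_in_prods by (auto simp: Pos_def Sup_eval)

lemma le_dpow_right_iff:
  assumes g: "g \<in> carrier G"
  shows "le g (\<delta> [^] (s::int)) \<longleftrightarrow> Sup g \<le> s"
proof -
  obtain P where P: "P \<in> Pos" "g = \<delta> [^] Inf g \<otimes> P"
    using Inf_obtain[OF g] .
  obtain u where u: "P = eval u" using P by (auto simp: Pos_def)
  have "Sup g = Inf g + int (length (nf u))"
    using Sup_eval P(2) u by metis
  moreover have "le g (\<delta> [^] s) \<longleftrightarrow> Inf g \<le> s \<and> P \<in> prods (nat (s - Inf g))"
    using le_dpow_right[OF P(1), of "Inf g" s] P(2) by simp
  ultimately show ?thesis by (auto simp: u eval_in_prods)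
qed

lemma Inf_inv: "g \<in> carrier G \<Longrightarrow> Inf (inv g) = - Sup g"
proof -
  assume g: "g \<in> carrier G"
  have "r \<le> Inf (inv g) \<longleftrightarrow> r \<le> - Sup g" for r
    using g le_dpow_iff[of "inv g" r] le_inv_dpow[OF g, of r] le_dpow_right_iff[OF g, of "- r"] by auto
  then show ?thesis by (metis order_antisym order_refl)
qed

lemma Sup_inv: "g \<in> carrier G \<Longrightarrow> Sup (inv g) = - Inf g"
  using Inf_inv[of "inv g"] by simp

lemma Inf_le_Sup: "g \<in> carrier G \<Longrightarrow> Inf g \<le> Sup g"
  using Inf_obtain Sup_prods by (metis le_add_same_cancel1 of_nat_0_le_iff)

lemma Inf_twist:
  assumes g: "g \<in> carrier G"
  shows "Inf (twist s g) = Inf g"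
proof -
  have "\<delta> [^] (- r) \<otimes> twist s g = twist s (\<delta> [^] (- r) \<otimes> g)" for r :: int
    using g by (simp add: twist_mult twist_dpow)
  then have "r \<le> Inf (twist s g) \<longleftrightarrow> r \<le> Inf g" for r
    using Inf_iff[of "twist s g" r] Inf_iff[of g r] g twist_Pos[of "\<delta> [^] (- r) \<otimes> g" s]
      twist_Pos[of "twist s (\<delta> [^] (- r) \<otimes> g)" "- s"] by (auto simp: twist_inverse)
  then show ?thesis by (metis order_antisym order_refl)
qed

subsection \<open>Cycling\<close>

lemma head_foldr_push:
  "head L = head M \<Longrightarrow> head (foldr push w L) = head (foldr push w M)"
  by (induction w) (auto simp: head_push)

text \<open>By \<open>head_push\<close>, left multiplication sees only the head of a normal form. If
  the head of h u is \<open>top\<close>, it is already \<open>top\<close> when u is replaced by its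
  first factor.\<close>

lemma top_absorb:
  assumes "h \<in> Pos" "X \<in> Pos" "h \<otimes> eval u = \<delta> \<otimes> X"
  shows "\<exists>h'\<in>Pos. h \<otimes> ev (head (nf u)) = \<delta> \<otimes> h'"
proof -
  define a where "a = head (nf u)"
  obtain w v where wv: "h = eval w" "X = eval v"
    using assms by (auto simp: Pos_def)
  have "nf (w @ u) = nf (top # v)"
    using assms(3) by (intro nf_cong) (simp add: wv eval_append)
  then have "foldr push w (nf u) = ptop (nf v)"
    by (simp add: nf_def ptop_def)
  then have "head (foldr push w (nf u)) = top"
    using hd_ptop by (simp add: head_def)
  \<comment> \<open>Includes \<open>a = one\<close>, because the head of the empty list is
    \<open>one\<close> by convention.\<close>
  moreover have "head (nf [a]) = a"
    by (simp add: nf_def head_def)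
  ultimately have "head (nf (w @ [a])) = top"
    using head_foldr_push[of "nf u" "nf [a]" w] by (simp add: a_def nf_def)
  then obtain M where "nf (w @ [a]) = top # M"
    using top_neq_one by (metis head_def list.collapse)
  then have "h \<otimes> ev a = \<delta> \<otimes> eval M"
    using eval_nf[of "w @ [a]"] by (simp add: wv eval_append)
  then show ?thesis by (auto simp: a_def Pos_def)
qed

section \<open>Conjugacy classes and the cycling argument\<close>

definition conjs :: "'a \<Rightarrow> 'a set" where
  "conjs x = {g \<otimes> x \<otimes> inv g |g. g \<in> carrier G}"

lemma conjsI: "g \<in> carrier G \<Longrightarrow> g \<otimes> x = y \<otimes> g \<Longrightarrow> y \<in> carrier G \<Longrightarrow> y \<in> conjs x"
  unfolding conjs_def by (intro CollectI exI[of _ g]) (simp add: m_assoc)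

lemma conjsE:
  assumes "y \<in> conjs x" "x \<in> carrier G"
  obtains g where "g \<in> carrier G" "y = g \<otimes> x \<otimes> inv g" "g \<otimes> x = y \<otimes> g" "y \<in> carrier G"
  using assms by (auto simp: conjs_def m_assoc)

lemma conjs_refl: "x \<in> carrier G \<Longrightarrow> x \<in> conjs x"
  by (rule conjsI[of \<one>]) auto

lemma conjs_trans:
  assumes "x \<in> carrier G" "y \<in> conjs x" "z \<in> conjs y"
  shows "z \<in> conjs x"
proof -
  obtain g where g: "g \<in> carrier G" "g \<otimes> x = y \<otimes> g" "y \<in> carrier G"
    using assms conjsE by metis
  obtain h where h: "h \<in> carrier G" "h \<otimes> y = z \<otimes> h" "z \<in> carrier G"
    using assms g conjsE by metis
  show ?thesis
    using g h assms(1) by (intro conjsI[of "h \<otimes> g"]) (simp_all add: m_assoc, simp flip: m_assoc)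
qed

lemma conjs_sym:
  assumes "x \<in> carrier G" "y \<in> conjs x"
  shows "x \<in> conjs y"
proof -
  obtain g where g: "g \<in> carrier G" "y = g \<otimes> x \<otimes> inv g" "y \<in> carrier G"
    using assms conjsE by metis
  then show ?thesis
    using assms(1) by (intro conjsI[of "inv g"]) (simp_all flip: m_assoc)
qed

lemma conjs_inv:
  assumes "x \<in> carrier G" "y \<in> conjs x"
  shows "inv y \<in> conjs (inv x)"
proof -
  obtain g where "g \<in> carrier G" "y = g \<otimes> x \<otimes> inv g"
    using assms conjsE by metis
  then show ?thesis
    using assms(1) unfolding conjs_def
    by (intro CollectI exI[of _ g]) (simp add: inv_mult_group m_assoc)
qed

lemma deg_conjs: "x \<in> carrier G \<Longrightarrow> y \<in> conjs x \<Longrightarrow> deg y = deg x"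
  by (auto simp: conjs_def deg_mult deg_inv)

lemma rank_less_top: "a \<noteq> top \<Longrightarrow> rank a < rank top"
  using mul_rc[of a] rank_mul rank_eq_0 by (metis mul_one_right add_cancel_left_right
      le_add1 nat_less_le option.inject)

text \<open>
  Let \<open>x = \<delta>\<^sup>r a R\<close> with \<open>a\<close> the greedy first factor.  If conjugating by \<open>h\<close> raises the infimum,
  then \<open>\<delta>\<close> is absorbed by \<open>h a\<close> (up to a twist); so, up to \<open>\<delta>\<close>, conjugating \<open>x\<close> by \<open>h\<close> is
  conjugating the cycled element \<open>\<delta>\<^sup>r R a\<close> by a shorter element.
\<close>

lemma Inf_raise_Pos:
  assumes "x \<in> carrier G" "h \<in> Pos" "Inf x < Inf (h \<otimes> x \<otimes> inv h)"
  shows "\<exists>y\<in>conjs x. Inf x < Inf y \<and> Sup y \<le> Sup x"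
  using assms
proof (induction "nat (deg h)" arbitrary: x h rule: less_induct)
  case (less h x)
  note x [simp] = \<open>x \<in> carrier G\<close> and h [simp] = Pos_closed[OF \<open>h \<in> Pos\<close>]
  define r where "r = Inf x"
  define y where "y = h \<otimes> x \<otimes> inv h"
  have y [simp]: "y \<in> carrier G" by (simp add: y_def)
  obtain P where P: "P \<in> Pos" "x = \<delta> [^] r \<otimes> P"
    using Inf_obtain[OF x] r_def by metis
  obtain u0 where "P = eval u0" using P by (auto simp: Pos_def)
  then obtain u where u: "P = eval u" "nf u = u"
    using eval_nf nf_cong by metis
  have Sup_x: "Sup x = r + int (length u)"
    using P u Sup_eval by simp
  define P' where "P' = \<delta> [^] (- (r + 1)) \<otimes> y"
  have "r + 1 \<le> Inf y"
    using less.prems(3) by (simp add: r_def y_def)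
  then have P': "P' \<in> Pos"
    unfolding P'_def by (simp only: Inf_iff[OF y])
  note [simp] = Pos_closed[OF P']
  \<comment> \<open>Both sides come from h x = y h: since y begins with \<delta>^(r+1), the twisted
    h times P begins with \<delta>, as \<open>top_absorb\<close> requires.\<close>
  have "twist (- r) h \<otimes> eval u = \<delta> [^] (- r) \<otimes> h \<otimes> x"
    by (simp add: twist_def m_assoc P(2) u(1))
  also have "\<dots> = \<delta> [^] (- r) \<otimes> y \<otimes> h"
    by (simp add: y_def m_assoc)
  also have "\<delta> [^] (- r) \<otimes> y = \<delta> \<otimes> P'"
    using dpow_mult[of 1 "- (r + 1)"] by (simp add: P'_def flip: m_assoc)
  finally have "twist (- r) h \<otimes> eval u = \<delta> \<otimes> (P' \<otimes> h)"
    by (simp add: m_assoc)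
  then obtain h' where h': "h' \<in> Pos" "twist (- r) h \<otimes> ev (head u) = \<delta> \<otimes> h'"
    using top_absorb[of "twist (- r) h" "P' \<otimes> h" u] u(2) P' less.prems(2)
    by (auto simp: Pos_mult twist_Pos)
  note [simp] = Pos_closed[OF h'(1)]
  define a where "a = head u"
  have split: "eval u = ev a \<otimes> eval (tl u)"
    by (cases u) (auto simp: a_def head_def)
  \<comment> \<open>Otherwise this factor would join \<delta>^r and raise
    \<open>Inf x\<close>.\<close>
  have "a \<noteq> top"
  proof
    assume "a = top"
    then have "x = \<delta> [^] (r + 1) \<otimes> eval (tl u)"
      using P(2) u(1) split by (simp add: dpow_mult m_assoc)
    then have "r + 1 \<le> Inf x"
      using Inf_ge[of "eval (tl u)" "r + 1"] by (simp add: Pos_def)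
    then show False by (simp add: r_def)
  qed
  \<comment> \<open>The first factor moved to the left of \<delta>^r. Hence
    \<open>c x1 = x c\<close> below, and \<open>x1\<close> is the cycling of
    \<open>x\<close>.\<close>
  define c where "c = twist r (ev a)"
  have c [simp]: "c \<in> carrier G" by (simp add: c_def)
  define x1 where "x1 = \<delta> [^] r \<otimes> (eval (tl u) \<otimes> c)"
  have x1 [simp]: "x1 \<in> carrier G" by (simp add: x1_def)
  have cx: "c \<otimes> x1 = x \<otimes> c"
    by (simp add: x1_def P(2) u(1) split c_def twist_def m_assoc dpow_cancel2)
  have x1_conj: "x1 \<in> conjs x"
    using cx conjs_sym[OF x1 conjsI[OF c cx x]] by simp
  have "eval (tl u) \<otimes> c \<in> prods (length u)"
  proof (cases u)
    case Nil
    then show ?thesis by (auto simp: c_def a_def head_def twist_one prods_def intro!: exI[of _ "[]"])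
  next
    case (Cons b v)
    have "eval v \<in> prods (length v)" by (auto simp: prods_def)
    then show ?thesis
      using prods_mult[OF _ twist_prods[OF ev_prods]] Cons by (fastforce simp: c_def)
  qed
  then have Sup_x1: "Sup x1 \<le> Sup x" and Inf_x1: "r \<le> Inf x1"
    using Sup_le Inf_ge prods_Pos Sup_x by (auto simp: x1_def)
  \<comment> \<open>The conjugator left over after cancelling \<delta>: conjugating
    \<open>x1\<close> by \<open>g\<close> gives \<open>y\<close> up to a twist, and deg g = deg h +
    rank a - rank top is smaller than deg h.\<close>
  define g where "g = twist r h'"
  have g_Pos: "g \<in> Pos" by (simp add: g_def twist_Pos h')
  note g [simp] = Pos_closed[OF g_Pos]
  have hc: "h \<otimes> c = \<delta> \<otimes> g"
  proof -
    have "h \<otimes> c = twist r (twist (- r) h \<otimes> ev a)"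
      by (simp add: twist_mult twist_inverse' c_def)
    also have "\<dots> = \<delta> \<otimes> g"
      using twist_dpow[of r 1] h'(2) by (simp add: a_def twist_mult g_def)
    finally show ?thesis .
  qed
  have "twist 1 (g \<otimes> x1 \<otimes> inv g) = y"
  proof -
    have "twist 1 (g \<otimes> x1 \<otimes> inv g) = \<delta> \<otimes> g \<otimes> x1 \<otimes> inv (\<delta> \<otimes> g)"
      by (simp add: twist_def inv_mult_group m_assoc int_pow_neg)
    also have "\<dots> = h \<otimes> (c \<otimes> x1) \<otimes> inv (h \<otimes> c)"
      by (simp add: m_assoc flip: hc)
    also have "\<dots> = y"
      by (simp add: cx y_def inv_mult_group m_assoc) (simp flip: m_assoc)
    finally show ?thesis .
  qed
  then have Inf_g: "Inf (g \<otimes> x1 \<otimes> inv g) = Inf y"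
    using Inf_twist[of "g \<otimes> x1 \<otimes> inv g" 1] by simp
  have "deg h + int (rank a) = deg \<delta> + deg g"
    using arg_cong[OF hc, of deg] by (simp add: deg_mult c_def deg_twist deg_ev)
  then have deg: "nat (deg g) < nat (deg h)"
    using rank_less_top[OF \<open>a \<noteq> top\<close>] deg_Pos[OF g_Pos] by (simp add: deg_ev)
  show ?case
  proof (cases "Inf x1 = r")
    case True
    then have "Inf x1 < Inf (g \<otimes> x1 \<otimes> inv g)"
      using less.prems(3) by (simp add: Inf_g r_def y_def)
    from less.hyps[OF deg x1 g_Pos this] obtain z
      where "z \<in> conjs x1" "r < Inf z" "Sup z \<le> Sup x1" using True by auto
    then show ?thesis
      using conjs_trans[OF x x1_conj] Sup_x1 by (auto simp: r_def intro!: bexI[of _ z])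
  next
    case False
    then show ?thesis
      using x1_conj Sup_x1 Inf_x1 by (auto simp: r_def intro!: bexI[of _ x1])
  qed
qed

text \<open>A power of \<delta> makes any conjugator positive; it merely twists \<open>y\<close>,
  which leaves \<open>Inf\<close> unchanged.\<close>

lemma Inf_raise:
  assumes x: "x \<in> carrier G" and "y \<in> conjs x" "Inf x < Inf y"
  shows "\<exists>z\<in>conjs x. Inf x < Inf z \<and> Sup z \<le> Sup x"
proof -
  obtain g where g: "g \<in> carrier G" "y = g \<otimes> x \<otimes> inv g" "y \<in> carrier G"
    using assms conjsE by metis
  obtain k where k: "\<delta> [^] (k::int) \<otimes> g \<in> Pos"
    using fractions[OF g(1)] by blast
  have "(\<delta> [^] k \<otimes> g) \<otimes> x \<otimes> inv (\<delta> [^] k \<otimes> g) = twist k y"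
    using g x by (simp add: twist_def inv_mult_group m_assoc int_pow_neg)
  then show ?thesis
    using Inf_raise_Pos[OF x k] assms(3) Inf_twist[OF g(3)] by simp
qed

lemma Sup_lower:
  assumes x: "x \<in> carrier G" and y: "y \<in> conjs x" "Sup y < Sup x"
  shows "\<exists>z\<in>conjs x. Sup z < Sup x \<and> Inf x \<le> Inf z"
proof -
  have "y \<in> carrier G" using x y conjsE by metis
  then obtain z where z: "z \<in> conjs (inv x)" "Inf (inv x) < Inf z" "Sup z \<le> Sup (inv x)"
    using Inf_raise[OF inv_closed[OF x] conjs_inv[OF x y(1)]] y x by (auto simp: Inf_inv)
  have "z \<in> carrier G" using z(1) x conjsE by (metis inv_closed)
  then show ?thesis
    using z conjs_inv[OF _ z(1)] x by (auto simp: Inf_inv Sup_inv intro!: bexI[of _ "inv z"])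
qed

text \<open>Raising \<open>Inf\<close> without raising \<open>Sup\<close>, or lowering
  \<open>Sup\<close> without lowering \<open>Inf\<close>, would make the canonical length smaller
  than the minimum.\<close>

theorem summit:
  assumes x: "x \<in> carrier G" and min: "\<And>z. z \<in> conjs x \<Longrightarrow> Sup x - Inf x \<le> Sup z - Inf z"
    and y: "y \<in> conjs x"
  shows "Inf y \<le> Inf x" "Sup x \<le> Sup y"
proof -
  show "Inf y \<le> Inf x"
    using Inf_raise[OF x y] min by (smt (verit))
  show "Sup x \<le> Sup y"
    using Sup_lower[OF x y] min by (smt (verit))
qed

end

section \<open>Canonical factors, summit sets and almost positive elements\<close>

context garside_group
begin

lemma canonical_iff: "A \<in> carrier G \<and> le \<one> A \<and> le A \<delta> \<longleftrightarrow> A \<in> range ev"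
proof
  assume A: "A \<in> carrier G \<and> le \<one> A \<and> le A \<delta>"
  then have "le (\<delta> [^] (0::int)) A" "le A (\<delta> [^] (1::int))" by simp_all
  with A have "A \<in> Pos" "Sup A \<le> 1"
    by (simp_all only: le_dpow le_dpow_right_iff) simp
  moreover obtain u where "A = eval u" using calculation by (auto simp: Pos_def)
  ultimately have "length (nf u) \<le> 1" "A = eval (nf u)"
    using Sup_eval[of 0 u] by (simp_all add: eval_nf)
  then show "A \<in> range ev"
    by (cases "nf u") (auto intro: range_eqI[of _ _ one])
next
  assume "A \<in> range ev"
  then obtain s where s: "A = ev s" by auto
  have "le (\<delta> [^] (0::int)) (ev s)" "le (ev s) (\<delta> [^] (1::int))"
    using ev_Pos[of s] Sup_le[OF ev_prods, of 0 s] by (simp_all only: le_dpow le_dpow_right_iff ev_closed) auto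
  then show "A \<in> carrier G \<and> le \<one> A \<and> le A \<delta>" by (simp add: s)
qed

text \<open>\<open>s\<close> is the head of the common normal form, hence \<open>s'\<close> divides
  \<open>s\<close>; as \<open>s\<close> also divides \<open>s'\<close>, the ranks force
  equality.\<close>

lemma greedy_maximal:
  assumes greedy: "slide s t = (s, t)" and eq: "ev s \<otimes> ev t = ev s' \<otimes> ev t'" "ev s' = ev s \<otimes> ev q"
  shows "s' = s"
proof -
  have "nf [s, t] = nf [s', t']"
    using eq(1) by (intro nf_cong) (simp flip: m_assoc)
  moreover have "head (nf [a, b]) = fst (slide a b)" for a b
    by (simp add: nf_def head_push) (simp add: head_def)
  ultimately have "fst (slide s' t') = s"
    using greedy by (metis fst_conv)
  then obtain d where "mul s' d = Some s"
    using slide_split by (metis prod.collapse)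
  moreover have "rank s' = rank s + rank q"
    using arg_cong[OF eq(2), of deg] by (simp add: deg_mult deg_ev)
  ultimately have "d = one"
    using rank_mul[of s' d s] rank_eq_0[of d] by simp
  with \<open>mul s' d = Some s\<close> show ?thesis by simp
qed

definition summit_set :: "'a \<Rightarrow> 'a set" where
  "summit_set x = {y \<in> conjs x. \<forall>z\<in>conjs x. Sup y - Inf y \<le> Sup z - Inf z}"

definition APos :: "'a set" where
  "APos = Pos \<union> {P \<otimes> inv (ev a) \<otimes> Q |P a Q. P \<in> Pos \<and> Q \<in> Pos \<and> rank a = 1}"

text \<open>Keeps the universal statements about the summit set from holding vacuously.\<close>

lemma summit_set_nonempty:
  assumes "x \<in> carrier G"
  shows "summit_set x \<noteq> {}"
proof -
  obtain y where y: "y \<in> conjs x" "\<And>z. z \<in> conjs x \<Longrightarrow> nat (Sup y - Inf y) \<le> nat (Sup z - Inf z)"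
    using ex_has_least_nat[of "\<lambda>y. y \<in> conjs x" x "\<lambda>y. nat (Sup y - Inf y)"] conjs_refl[OF assms]
    by blast
  have "Sup y - Inf y \<le> Sup z - Inf z" if "z \<in> conjs x" for z
    using y(2)[OF that] Inf_le_Sup[of z] that assms by (auto elim: conjsE)
  then show ?thesis using y(1) by (auto simp: summit_set_def)
qed

lemma summit_set_bounds:
  assumes x: "x \<in> carrier G" and y: "y \<in> summit_set x" and z: "z \<in> conjs x"
  shows "Inf z \<le> Inf y" "Sup y \<le> Sup z"
proof -
  have yx: "y \<in> conjs x" "y \<in> carrier G"
    using y x by (auto simp: summit_set_def elim: conjsE)
  have sub: "w \<in> conjs x" if "w \<in> conjs y" for w
    using conjs_trans[OF x yx(1) that] .
  have "z \<in> conjs y"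
    using conjs_trans[OF yx(2) conjs_sym[OF x yx(1)] z] .
  then show "Inf z \<le> Inf y" "Sup y \<le> Sup z"
    using summit[OF yx(2), of z] sub y by (auto simp: summit_set_def)
qed

lemma Pos_iff_Inf: "g \<in> carrier G \<Longrightarrow> g \<in> Pos \<longleftrightarrow> 0 \<le> Inf g"
  using Inf_iff[of g 0] by simp

lemma conjs_Pos_iff:
  assumes x: "x \<in> carrier G" and y: "y \<in> summit_set x"
  shows "conjs x \<inter> Pos \<noteq> {} \<longleftrightarrow> 0 \<le> Inf y"
proof -
  have yx: "y \<in> conjs x" "y \<in> carrier G"
    using y x by (auto simp: summit_set_def elim: conjsE)
  have "z \<in> Pos \<longleftrightarrow> 0 \<le> Inf z" if "z \<in> conjs x" for z
    using that x Pos_iff_Inf by (auto elim: conjsE)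
  then show ?thesis
    using summit_set_bounds[OF x y] yx by fastforce
qed

lemma APos_normalize:
  assumes x: "x \<in> carrier G" and "conjs x \<inter> APos \<noteq> {}" "conjs x \<inter> Pos = {}"
  shows "\<exists>c Q. Q \<in> Pos \<and> Suc (rank c) = rank top \<and> \<delta> [^] (- 1 :: int) \<otimes> (ev c \<otimes> Q) \<in> conjs x"
proof -
  obtain P a Q where PQ: "P \<in> Pos" "Q \<in> Pos" "rank a = 1" "P \<otimes> inv (ev a) \<otimes> Q \<in> conjs x"
    using assms by (auto simp: APos_def)
  note [simp] = Pos_closed[OF PQ(1)] Pos_closed[OF PQ(2)]
  have \<delta>: "\<delta> = ev (lc a) \<otimes> ev a"
    using ev_mul[OF mul_lc] by simp
  have "\<delta> [^] (- 1 :: int) \<otimes> \<delta> = \<one>"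
    using dpow_cancel(1)[of 1] by simp
  then have "\<delta> [^] (- 1 :: int) \<otimes> ev (lc a) \<otimes> ev a = \<one>"
    by (simp add: \<delta>[symmetric] m_assoc)
  then have inv: "\<delta> [^] (- 1 :: int) \<otimes> ev (lc a) = inv (ev a)"
    by (metis inv_equality inv_inv int_pow_closed ev_closed m_closed inv_comm)
  have "\<delta> [^] (- 1 :: int) \<otimes> (ev (lc a) \<otimes> (Q \<otimes> P)) = inv (ev a) \<otimes> Q \<otimes> P"
    by (simp add: m_assoc flip: inv)
  \<comment> \<open>Conjugation by \<open>inv (ev a) \<otimes> Q\<close> rotates \<open>P\<close> to
    the end.\<close>
  moreover have "inv (ev a) \<otimes> Q \<otimes> P \<in> conjs (P \<otimes> inv (ev a) \<otimes> Q)"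
    by (rule conjsI[of "inv (ev a) \<otimes> Q"]) (simp_all add: m_assoc)
  ultimately have "\<delta> [^] (- 1 :: int) \<otimes> (ev (lc a) \<otimes> (Q \<otimes> P)) \<in> conjs x"
    using conjs_trans[OF x PQ(4)] by simp
  moreover have "Suc (rank (lc a)) = rank top"
    using rank_mul[OF mul_lc[of a]] PQ(3) by simp
  ultimately show ?thesis
    using Pos_mult[OF PQ(2,1)] by blast
qed

lemma APos_corank1:
  assumes "Suc (rank c) = rank top" "Q \<in> Pos"
  shows "\<delta> [^] (- 1 :: int) \<otimes> (ev c \<otimes> Q) \<in> APos"
proof -
  note [simp] = Pos_closed[OF assms(2)]
  obtain a where a: "mul c a = Some top" using mul_rc by blast
  then have "rank a = 1" using rank_mul[OF a] assms by simp
  have "\<delta> [^] (- 1 :: int) \<otimes> \<delta> = \<one>"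
    using dpow_cancel(1)[of 1] by simp
  then have "\<delta> [^] (- 1 :: int) \<otimes> ev c \<otimes> ev a = \<one>"
    using ev_mul[OF a] by (simp add: m_assoc)
  then have "\<delta> [^] (- 1 :: int) \<otimes> ev c = inv (ev a)"
    by (metis inv_equality inv_inv int_pow_closed ev_closed m_closed inv_comm)
  then have "\<delta> [^] (- 1 :: int) \<otimes> (ev c \<otimes> Q) = \<one> \<otimes> inv (ev a) \<otimes> Q"
    by (simp flip: m_assoc)
  then show ?thesis
    using \<open>rank a = 1\<close> assms(2) one_Pos unfolding APos_def by blast
qed

text \<open>Conjugation by the suffix starting at \<open>s\<close> rotates that suffix to the front.
  Crossing \<delta>^-1 twists it, which keeps the rank of \<open>s\<close>, so \<delta>^-1 is
  followed by a factor of corank one.\<close>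

lemma APos_of_factor:
  assumes "s \<in> set us" "Suc (rank s) = rank top"
  shows "conjs (\<delta> [^] (- 1 :: int) \<otimes> eval us) \<inter> APos \<noteq> {}"
proof -
  obtain xs ys where us: "us = xs @ s # ys"
    using assms(1) by (meson split_list)
  obtain t where t: "twist 1 (ev s) = ev t" using twist_ev by blast
  have "rank t = rank s"
    using arg_cong[OF t, of deg] by (simp add: deg_twist deg_ev)
  define Q where "Q = twist 1 (eval ys) \<otimes> eval xs"
  have Q: "Q \<in> Pos" unfolding Q_def by (intro Pos_mult twist_Pos) (auto simp: Pos_def)
  have 1: "\<delta> [^] (- 1 :: int) \<otimes> twist 1 z = z \<otimes> \<delta> [^] (- 1 :: int)" if "z \<in> carrier G" for z
    using that dpow_cancel2(1)[of _ 1] by (simp add: twist_def m_assoc)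
  have "ev s \<otimes> eval ys \<otimes> \<delta> [^] (- 1 :: int) \<otimes> eval xs =
      \<delta> [^] (- 1 :: int) \<otimes> (ev t \<otimes> Q)"
    using 1[of "ev s \<otimes> eval ys"] by (simp add: twist_mult t Q_def) (simp flip: m_assoc)
  moreover have "ev s \<otimes> eval ys \<otimes> \<delta> [^] (- 1 :: int) \<otimes> eval xs
      \<in> conjs (\<delta> [^] (- 1 :: int) \<otimes> eval us)"
    by (rule conjsI[of "ev s \<otimes> eval ys"]) (simp_all add: us eval_append m_assoc)
  ultimately show ?thesis
    using APos_corank1[OF _ Q, of t] assms(2) \<open>rank t = rank s\<close> by auto
qed

lemma Inf_summit_APos:
  assumes x: "x \<in> carrier G" and A: "conjs x \<inter> APos \<noteq> {}" "conjs x \<inter> Pos = {}"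
    and y: "y \<in> summit_set x"
  shows "Inf y = - 1"
proof -
  obtain c Q where cQ: "Q \<in> Pos" "\<delta> [^] (- 1 :: int) \<otimes> (ev c \<otimes> Q) \<in> conjs x"
    using APos_normalize[OF x A] by blast
  then have "- 1 \<le> Inf y"
    using summit_set_bounds(1)[OF x y cQ(2)] Inf_ge[OF Pos_mult[OF ev_Pos cQ(1)]] order_trans by blast
  moreover have "\<not> 0 \<le> Inf y"
    using conjs_Pos_iff[OF x y] A by simp
  ultimately show ?thesis by simp
qed

lemma Inf_neg_form:
  assumes "y \<in> carrier G" "Inf y = - 1"
  obtains us where "y = \<delta> [^] (- 1 :: int) \<otimes> eval us" "nf us = us" "one \<notin> set us" "top \<notin> set us"
proof -
  obtain P where P: "P \<in> Pos" "y = \<delta> [^] (- 1 :: int) \<otimes> P"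
    using Inf_obtain[OF assms(1)] assms(2) by metis
  then obtain u0 where u0: "P = eval u0" by (auto simp: Pos_def)
  define us where "us = nf u0"
  have us: "y = \<delta> [^] (- 1 :: int) \<otimes> eval us" "nf us = us"
    using P u0 eval_nf nf_cong us_def by metis+
  \<comment> \<open>A factor \<open>top\<close> would cancel \<delta>^-1 after twisting what lies
    between, leaving a positive element.\<close>
  have "top \<notin> set us"
  proof
    assume "top \<in> set us"
    then obtain xs ys where s: "us = xs @ top # ys"
      by (meson split_list)
    have "y = \<delta> [^] (- 1 :: int) \<otimes> eval xs \<otimes> \<delta> [^] (- (- 1) :: int) \<otimes> eval ys"
      using us(1) s by (simp add: eval_append m_assoc)
    then have "y = twist (- 1) (eval xs) \<otimes> eval ys"
      by (simp only: twist_def)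
    moreover have "twist (- 1) (eval xs) \<otimes> eval ys \<in> Pos"
      by (intro Pos_mult twist_Pos) (auto simp: Pos_def)
    ultimately show False
      using Pos_iff_Inf[OF assms(1)] assms(2) by simp
  qed
  then show ?thesis using that us one_notin_nf us_def by metis
qed

lemma nf_length_deg: "int (length (nf u)) \<le> deg (eval u)"
proof -
  have "one \<notin> set us \<Longrightarrow> length us \<le> (\<Sum>s\<leftarrow>us. rank s)" for us
  proof (induction us)
    case (Cons s us)
    then show ?case using rank_eq_0[of s] by (cases "rank s") auto
  qed simp
  from this[OF one_notin_nf, of u] show ?thesis
    using deg_eval[of "nf u"] by (simp add: eval_nf)
qed

text \<open>
  Canonical factors of rank one are as inefficient as possible: a word in them has a larger
  supremum than an almost positive braid of the same degree.
\<close>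

lemma summit_factor:
  assumes x: "x \<in> carrier G" and A: "conjs x \<inter> APos \<noteq> {}" "conjs x \<inter> Pos = {}"
    and y: "y \<in> summit_set x" "y = \<delta> [^] (- 1 :: int) \<otimes> eval us" "nf us = us" and top: "2 < rank top"
  shows "\<exists>s\<in>set us. rank s \<noteq> 1"
proof (rule ccontr)
  assume "\<not> ?thesis"
  then have "(\<Sum>s\<leftarrow>us. rank s) = (\<Sum>s\<leftarrow>us. 1)"
    by (intro arg_cong[of _ _ sum_list] map_cong) auto
  then have deg_us: "deg (eval us) = int (length us)"
    by (simp add: deg_eval sum_list_triv)
  obtain c Q where cQ: "Q \<in> Pos" "Suc (rank c) = rank top"
    "\<delta> [^] (- 1 :: int) \<otimes> (ev c \<otimes> Q) \<in> conjs x" (is "?z \<in> _")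
    using APos_normalize[OF x A] by blast
  obtain w where w: "Q = eval w" using cQ by (auto simp: Pos_def)
  \<comment> \<open>\<open>c\<close> costs one factor, which offsets the exponent -1; each factor in
    the normal form of \<open>Q\<close> has rank at least one.\<close>
  have "Sup ?z \<le> - 1 + int (1 + length (nf w))"
    by (intro Sup_le) (use prods_mult[OF ev_prods, of Q] w eval_in_prods in auto)
  also have "\<dots> \<le> deg Q" using nf_length_deg[of w] w by simp
  finally have "Sup y \<le> deg Q"
    using summit_set_bounds(2)[OF x y(1) cQ(3)] by simp
  moreover have "Sup y = - 1 + int (length us)"
    using Sup_eval y by simp
  moreover have "y \<in> conjs x" using y(1) by (simp add: summit_set_def)
  then have "deg y = deg ?z"
    using deg_conjs[OF x] cQ(3) by simp
  then have "int (length us) = int (rank c) + deg Q"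
    using y(2) deg_us w deg_mult[of "\<delta> [^] (- 1 :: int)" "eval us"]
    by (simp add: deg_mult deg_ev)
  \<comment> \<open>Together: -1 + rank c + deg Q = Sup y \<le> deg Q, so rank top \<le> 2.\<close>
  ultimately show False using top cQ(2) by simp
qed

text \<open>With rank top = 2 every factor other than \<open>one\<close> and \<open>top\<close> has
  corank one, so any factor at all is enough. The hypothesis \<open>nx\<close> provides one:
  \<delta>^-1 has infimum -1 but degree -2, below the bound -1 on degrees in
  \<open>APos\<close>.\<close>

theorem APos_iff_rank2:
  assumes x: "x \<in> carrier G" and top: "rank top = 2" and nx: "x \<notin> conjs (\<delta> [^] (- 1 :: int))"
  shows "conjs x \<inter> APos \<noteq> {} \<and> conjs x \<inter> Pos = {} \<longleftrightarrow> (\<forall>y\<in>summit_set x. Inf y = - 1)"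
proof (intro iffI ballI)
  fix y assume "conjs x \<inter> APos \<noteq> {} \<and> conjs x \<inter> Pos = {}" "y \<in> summit_set x"
  then show "Inf y = - 1" using Inf_summit_APos x by simp
next
  assume *: "\<forall>y\<in>summit_set x. Inf y = - 1"
  obtain y where y: "y \<in> summit_set x" using summit_set_nonempty[OF x] by blast
  then have yx: "y \<in> conjs x" "y \<in> carrier G"
    using x by (auto simp: summit_set_def elim: conjsE)
  obtain us where us: "y = \<delta> [^] (- 1 :: int) \<otimes> eval us" "one \<notin> set us" "top \<notin> set us"
    using Inf_neg_form[OF yx(2)] * y by metis
  have "us \<noteq> []"
    using us(1) nx conjs_sym[OF x yx(1)] by auto
  then obtain s where s: "s \<in> set us" by (cases us) auto
  with us have "rank s < 2" "rank s \<noteq> 0"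
    using rank_less_top[of s] rank_eq_0[of s] top by auto
  then have "Suc (rank s) = rank top" using top by simp
  then have "conjs y \<inter> APos \<noteq> {}"
    using APos_of_factor[OF s] us(1) by simp
  then have "conjs x \<inter> APos \<noteq> {}"
    using conjs_trans[OF x yx(1)] by blast
  moreover have "conjs x \<inter> Pos = {}"
    using conjs_Pos_iff[OF x y] * y by auto
  ultimately show "conjs x \<inter> APos \<noteq> {} \<and> conjs x \<inter> Pos = {}" by blast
qed

text \<open>Corank one now means rank two. \<open>summit_factor\<close> finds such a factor in every
  summit element, and \<open>APos_of_factor\<close> uses one for the converse.\<close>

theorem APos_iff_rank3:
  assumes x: "x \<in> carrier G" and top: "rank top = 3"
  shows "conjs x \<inter> APos \<noteq> {} \<and> conjs x \<inter> Pos = {} \<longleftrightarrow>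
    (\<forall>y\<in>summit_set x. Inf y = - 1 \<and>
      (\<exists>us. y = \<delta> [^] (- 1 :: int) \<otimes> eval us \<and> set us \<subseteq> - {one, top} \<and>
        (\<forall>i. Suc i < length us \<longrightarrow> slide (us ! i) (us ! Suc i) = (us ! i, us ! Suc i)) \<and>
        (\<exists>s\<in>set us. rank s = 2)))"
    (is "_ \<longleftrightarrow> (\<forall>y\<in>summit_set x. Inf y = - 1 \<and> (\<exists>us. ?F y us))")
proof (intro iffI ballI)
  fix y assume A: "conjs x \<inter> APos \<noteq> {} \<and> conjs x \<inter> Pos = {}" and y: "y \<in> summit_set x"
  then have Inf: "Inf y = - 1" using Inf_summit_APos x by simp
  have "y \<in> carrier G"
    using x y by (auto simp: summit_set_def elim: conjsE)
  then obtain us where us: "y = \<delta> [^] (- 1 :: int) \<otimes> eval us" "nf us = us" "one \<notin> set us" "top \<notin> set us"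
    using Inf_neg_form[OF _ Inf] by metis
  obtain s where s: "s \<in> set us" "rank s \<noteq> 1"
    using summit_factor[OF x _ _ y us(1,2)] A top by auto
  have "rank s < 3" "rank s \<noteq> 0"
    using s us rank_less_top[of s] rank_eq_0[of s] top by auto
  then have "rank s = 2" using s by simp
  moreover have "set us \<subseteq> - {one, top}" using us by auto
  ultimately have "?F y us"
    using s us(1) nf_greedy[of _ us] us(2) by auto
  then show "Inf y = - 1 \<and> (\<exists>us. ?F y us)" using Inf by blast
next
  assume *: "\<forall>y\<in>summit_set x. Inf y = - 1 \<and> (\<exists>us. ?F y us)"
  obtain y where y: "y \<in> summit_set x" using summit_set_nonempty[OF x] by blast
  then have yx: "y \<in> conjs x" using x by (simp add: summit_set_def)
  obtain us s where us: "y = \<delta> [^] (- 1 :: int) \<otimes> eval us" "s \<in> set us" "rank s = 2"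
    using * y by blast
  then have "conjs y \<inter> APos \<noteq> {}"
    using APos_of_factor[OF us(2)] top by simp
  then have "conjs x \<inter> APos \<noteq> {}"
    using conjs_trans[OF x yx] by blast
  moreover have "conjs x \<inter> Pos = {}"
    using conjs_Pos_iff[OF x y] * y by auto
  ultimately show "conjs x \<inter> APos \<noteq> {} \<and> conjs x \<inter> Pos = {}" by blast
qed

end

section \<open>Braid groups as groups of fractions of a germ\<close>

text \<open>The exponent of the central correction: in the action below each inverse letter
  contributes one \<open>cen\<close>.\<close>

definition negs :: "artin_word \<Rightarrow> nat" where
  "negs w = length (filter (\<lambda>(b, i). \<not> b) w)"

definition word_deg :: "artin_word \<Rightarrow> int" where
  "word_deg w = (\<Sum>(b, i)\<leftarrow>w. if b then 1 else - 1)"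

definition braid_deg :: "artin_word set \<Rightarrow> int" where
  "braid_deg X = word_deg (SOME w. w \<in> X)"

abbreviation cls :: "nat \<Rightarrow> artin_word \<Rightarrow> artin_word set" where
  "cls n w \<equiv> artin_rel n `` {w}"

lemma negs_simps [simp]:
  "negs [] = 0" "negs ((b, i) # w) = (if b then negs w else Suc (negs w))"
  "negs (u @ v) = negs u + negs v"
  by (auto simp: negs_def)

lemma word_deg_simps [simp]:
  "word_deg [] = 0" "word_deg ((b, i) # w) = (if b then 1 else - 1) + word_deg w"
  "word_deg (u @ v) = word_deg u + word_deg v"
  by (auto simp: word_deg_def)

lemma artin_words_Cons: "(b, i) # w \<in> artin_words n \<longleftrightarrow> i \<in> {1..<n} \<and> w \<in> artin_words n"
  by (auto simp: artin_words_def)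

lemma inverse_word_inverse: "inverse_word (inverse_word w) = w"
  by (induction w) (auto simp: inverse_word_def rev_map)

lemma word_deg_artin_rel: "(u, v) \<in> artin_rel n \<Longrightarrow> word_deg u = word_deg v"
  by (induction rule: artin_rel.induct) auto

lemma braid_deg_cls:
  assumes "w \<in> artin_words n"
  shows "braid_deg (cls n w) = word_deg w"
proof -
  have "w \<in> cls n w" using assms by (auto intro: artin_rel.refl)
  then have "(w, SOME v. v \<in> cls n w) \<in> artin_rel n"
    using someI[of "\<lambda>v. v \<in> cls n w"] by blast
  then show ?thesis unfolding braid_deg_def using word_deg_artin_rel by metis
qed

lemma cls_closed: "w \<in> artin_words n \<Longrightarrow> cls n w \<in> carrier (braid_group n)"
  by (auto simp: carrier_braid_group)

lemma cls_eq: "u \<in> artin_words n \<Longrightarrow> v \<in> artin_words n \<Longrightarrow> cls n u = cls n v \<longleftrightarrow> (u, v) \<in> artin_rel n"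
  using eq_equiv_class_iff[OF equiv_artin_rel] by blast

lemma cls_Nil: "cls n [] = \<one>\<^bsub>braid_group n\<^esub>"
  by (simp add: braid_group_def)

lemma cls_inverse:
  assumes "w \<in> artin_words n"
  shows "inv\<^bsub>braid_group n\<^esub> (cls n w) = cls n (inverse_word w)"
proof -
  interpret group "braid_group n" by (rule group_braid_group)
  have "cls n (inverse_word w) \<otimes>\<^bsub>braid_group n\<^esub> cls n w = \<one>\<^bsub>braid_group n\<^esub>"
    using assms inverse_word_in_artin_words inverse_word_left
    by (simp add: mult_class_artin_rel cls_eq flip: cls_Nil)
  then show ?thesis
    using assms inverse_word_in_artin_words by (intro inv_equality) (auto intro: cls_closed)
qed

text \<open>\<open>gen_induct\<close> permits division because a band such as
  \<open>band n 1 3\<close> is no product of Artin generators, only a quotient of such products. In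
  \<open>gen_braid\<close>, \<open>c\<close> is the third side of the triangle spanned by two
  adjacent generators.\<close>

locale braid_germ = germ one top mul slide lc period rank
  for one top :: 'f and mul slide lc period rank +
  fixes n :: nat
    and ev :: "'f \<Rightarrow> artin_word set"
    and gen :: "nat \<Rightarrow> 'f"
  assumes ev_carrier: "ev s \<in> carrier (braid_group n)"
    and ev_unit: "ev one = \<one>\<^bsub>braid_group n\<^esub>"
    and ev_delta: "ev top = delta n"
    and ev_hom: "mul s t = Some p \<Longrightarrow> ev s \<otimes>\<^bsub>braid_group n\<^esub> ev t = ev p"
    and ev_gen: "i \<in> {1..<n} \<Longrightarrow> ev (gen i) = artin_gen n i"
    and rank_gen: "i \<in> {1..<n} \<Longrightarrow> rank (gen i) = 1"
    and gen_far: "i \<in> {1..<n} \<Longrightarrow> j \<in> {1..<n} \<Longrightarrow> i + 2 \<le> j \<Longrightarrow>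
      \<exists>p. mul (gen i) (gen j) = Some p \<and> mul (gen j) (gen i) = Some p"
    and gen_braid: "i \<in> {1..<n} \<Longrightarrow> Suc i \<in> {1..<n} \<Longrightarrow>
      \<exists>c p. mul (gen (Suc i)) (gen i) = Some p \<and> mul (gen i) c = Some p \<and>
        mul c (gen (Suc i)) = Some p"
    and gen_induct: "Q one \<Longrightarrow> (\<And>i. i \<in> {1..<n} \<Longrightarrow> Q (gen i)) \<Longrightarrow>
      (\<And>s t p. mul s t = Some p \<Longrightarrow> Q s \<Longrightarrow> Q t \<Longrightarrow> Q p) \<Longrightarrow>
      (\<And>s t p. mul s t = Some p \<Longrightarrow> Q p \<Longrightarrow> Q t \<Longrightarrow> Q s) \<Longrightarrow> Q x"
    and ev_band: "{ev s |s. rank s = 1} = {band n i j |i j. 1 \<le> i \<and> i < j \<and> j \<le> n}"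
    and rank_decomp: "1 < rank s \<Longrightarrow> \<exists>t u. mul t u = Some s \<and> rank t = 1"
begin

text \<open>
  The braid group acts on good lists up to powers of the central map \<open>cen\<close>: an inverse letter
  acts by the left complement of its generator times a power of \<open>top\<close>.
\<close>

definition push_inv :: "nat \<Rightarrow> 'f list \<Rightarrow> 'f list" where
  "push_inv i L = (ptop ^^ (period - 1)) (push (lc (gen i)) L)"

fun act :: "artin_word \<Rightarrow> 'f list \<Rightarrow> 'f list" where
  "act [] L = L"
| "act ((b, i) # w) L = (if b then push (gen i) (act w L) else push_inv i (act w L))"

lemma push_inv_push: "push_inv i (push (gen i) L) = cen L"
proof -
  have "cen L = (ptop ^^ Suc (period - 1)) L"
    using lc_period(1) by (simp add: cen_def del: funpow.simps)
  also have "\<dots> = (ptop ^^ (period - 1)) (push top L)"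
    by (simp add: funpow_Suc_right ptop_def del: funpow.simps)
  finally show ?thesis
    by (simp add: push_inv_def push_push[OF mul_lc])
qed

lemma good_push_inv: "good L \<Longrightarrow> good (push_inv i L)"
  by (simp add: push_inv_def good_ptop_pow good_push)

lemma push_inv_inj: "good L \<Longrightarrow> good M \<Longrightarrow> push_inv i L = push_inv i M \<Longrightarrow> L = M"
  unfolding push_inv_def using ptop_pow_inj push_inj good_push by metis

lemma cen_pow_push_inv: "(cen ^^ k) (push_inv i L) = push_inv i ((cen ^^ k) L)"
proof -
  have comm: "(ptop ^^ a) ((ptop ^^ b) M) = (ptop ^^ b) ((ptop ^^ a) M)" for a b M
    using fun_cong[OF funpow_add[of a b ptop], of M] fun_cong[OF funpow_add[of b a ptop], of M]
    by (simp add: add.commute)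
  have "(cen ^^ k) (push_inv i L) = (ptop ^^ (period - 1)) ((cen ^^ k) (push (lc (gen i)) L))"
    unfolding push_inv_def cen_pow by (rule comm)
  then show ?thesis by (simp add: push_inv_def cen_pow_push)
qed

text \<open>The one-sided law \<open>push_inv_push\<close> gives the other side after applying the
  injective \<open>push_inv i\<close>, since \<open>cen\<close> commutes with it.\<close>

lemma push_push_inv: "good L \<Longrightarrow> push (gen i) (push_inv i L) = cen L"
  using push_inv_push[of i "push_inv i L"] cen_pow_push_inv[of 1 i L] good_cen_pow[of L 1]
  by (rule_tac push_inv_inj[of _ _ i]) (simp_all add: good_push good_push_inv)

lemma good_act: "good L \<Longrightarrow> good (act w L)"
  by (induction w) (auto simp: good_push good_push_inv)

lemma act_append: "act (u @ v) L = act u (act v L)"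
  by (induction u) auto

lemma cen_pow_act: "(cen ^^ k) (act w L) = act w ((cen ^^ k) L)"
  by (induction w) (auto simp: cen_pow_push cen_pow_push_inv)

lemma cen_pow_add: "(cen ^^ (j + k)) L = (cen ^^ j) ((cen ^^ k) L)"
  by (simp add: funpow_add)

text \<open>\<open>act w\<close> stands for w times \<open>cen\<close> to the power
  \<open>negs w\<close>. Related words may differ in \<open>negs\<close>, so each side receives the
  count of the other; transitivity then has to cancel \<open>cen\<close>, hence the restriction to
  good lists.\<close>

lemma act_artin_rel:
  assumes "(u, v) \<in> artin_rel n" "good L"
  shows "(cen ^^ negs v) (act u L) = (cen ^^ negs u) (act v L)"
  using assms
proof (induction arbitrary: L rule: artin_rel.induct)
  case (trans u v w)
  have "(cen ^^ negs v) ((cen ^^ negs w) (act u L)) = (cen ^^ negs w) ((cen ^^ negs v) (act u L))"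
    by (simp add: add.commute flip: cen_pow_add)
  also have "\<dots> = (cen ^^ negs w) ((cen ^^ negs u) (act v L))"
    by (simp only: trans.IH(1)[OF trans.prems])
  also have "\<dots> = (cen ^^ negs u) ((cen ^^ negs w) (act v L))"
    by (simp add: add.commute flip: cen_pow_add)
  also have "\<dots> = (cen ^^ negs u) ((cen ^^ negs v) (act w L))"
    by (simp only: trans.IH(2)[OF trans.prems])
  also have "\<dots> = (cen ^^ negs v) ((cen ^^ negs u) (act w L))"
    by (simp add: add.commute flip: cen_pow_add)
  finally show ?case
    using trans.prems by (auto dest!: cen_pow_inj[rotated 2] simp: good_cen_pow good_act)
next
  case (cong u u' v v')
  have "(cen ^^ negs (u' @ v')) (act (u @ v) L) = (cen ^^ negs u') (act u ((cen ^^ negs v') (act v L)))"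
    by (simp add: act_append cen_pow_add cen_pow_act)
  also have "\<dots> = (cen ^^ negs u') (act u ((cen ^^ negs v) (act v' L)))"
    by (simp add: cong)
  also have "\<dots> = (cen ^^ negs u) (act u' ((cen ^^ negs v) (act v' L)))"
    by (simp add: cong good_cen_pow good_act)
  also have "\<dots> = (cen ^^ negs (u @ v)) (act (u' @ v') L)"
    by (simp add: act_append cen_pow_add cen_pow_act)
  finally show ?case .
next
  case (cancel i b)
  then show ?case by (auto simp: push_inv_push push_push_inv)
next
  case (far i j)
  then show ?case using gen_far[of i j] push_push by auto
next
  case (braid i)
  obtain c p where c: "mul (gen (Suc i)) (gen i) = Some p" "mul (gen i) c = Some p"
    "mul c (gen (Suc i)) = Some p"
    using gen_braid[OF braid(1,2)] by blast
  \<comment> \<open>With x = \<open>gen i\<close> and y = \<open>gen (Suc i)\<close>: p y = x c y =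
    x p.\<close>
  have "push p (push (gen (Suc i)) L) = push (gen i) (push p L)"
    using push_push[OF c(2), of "push (gen (Suc i)) L"] push_push[OF c(3), of L] by simp
  then show ?case
    using push_push[OF c(1)] by simp
qed auto

text \<open>Joins the two faces of a factor, its value in the group and its operation on normal
  forms, through a single word.\<close>

definition represents :: "artin_word \<Rightarrow> 'f \<Rightarrow> bool" where
  "represents w s \<longleftrightarrow> w \<in> artin_words n \<and> ev s = cls n w \<and>
    (\<forall>L. good L \<longrightarrow> act w L = (cen ^^ negs w) (push s L))"

lemma ex_represents: "\<exists>w. represents w s"
proof (induction rule: gen_induct)
  case 1
  have "represents [] one"
    by (simp add: represents_def ev_unit cls_Nil push_one)
  then show ?case by blast
next
  case (2 i)
  then have "represents [(True, i)] (gen i)"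
    by (simp add: represents_def ev_gen artin_gen_def artin_words_Cons)
  then show ?case by blast
next
  case (3 s t p)
  then obtain u v where u: "represents u s" and v: "represents v t" by blast
  have "ev p = cls n (u @ v)"
    using u v ev_hom[OF 3(1)] by (simp add: represents_def mult_class_artin_rel)
  moreover have "act (u @ v) L = (cen ^^ negs (u @ v)) (push p L)" if "good L" for L
  proof -
    have "act (u @ v) L = (cen ^^ negs u) (push s ((cen ^^ negs v) (push t L)))"
      using u v that by (simp add: represents_def act_append good_cen_pow good_push)
    then show ?thesis
      using push_push[OF 3(1)] by (simp add: cen_pow_add flip: cen_pow_push)
  qed
  ultimately have "represents (u @ v) p"
    using u v by (simp add: represents_def)
  then show ?case by blast
next
  case (4 s t p)
  then obtain u v where u: "represents u p" and v: "represents v t" by blast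
  interpret group "braid_group n" by (rule group_braid_group)
  have words: "u \<in> artin_words n" "v \<in> artin_words n" "inverse_word v \<in> artin_words n"
    using u v by (auto simp: represents_def inverse_word_in_artin_words)
  have "ev s = ev p \<otimes>\<^bsub>braid_group n\<^esub> inv\<^bsub>braid_group n\<^esub> ev t"
    using ev_hom[OF 4(1)] ev_carrier by (metis inv_solve_right)
  then have "ev s = cls n (u @ inverse_word v)"
    using u v words by (simp add: represents_def cls_inverse mult_class_artin_rel)
  \<comment> \<open>\<open>v\<close> cancels its inverse only up to central powers, so the identity
    is proved after applying \<open>cen\<close> \<open>negs v\<close> more times.\<close>
  moreover have "act (u @ inverse_word v) L = (cen ^^ negs (u @ inverse_word v)) (push s L)"
    if L: "good L" for L
  proof (rule cen_pow_inj[where k = "negs v"])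
    define M where "M = act (inverse_word v) L"
    have M: "good M" by (simp add: M_def good_act L)
    have "(v @ inverse_word v, []) \<in> artin_rel n"
      using inverse_word_left[OF words(3)] by (simp add: inverse_word_inverse)
    from act_artin_rel[OF this L] have "act v M = (cen ^^ (negs v + negs (inverse_word v))) L"
      by (simp add: act_append M_def)
    then have *: "(cen ^^ negs v) (push t M) = (cen ^^ (negs v + negs (inverse_word v))) L"
      using v M by (simp add: represents_def)
    have "(cen ^^ negs v) (act (u @ inverse_word v) L) =
        (cen ^^ negs v) ((cen ^^ negs u) (push s (push t M)))"
      using u M push_push[OF 4(1)] by (simp add: represents_def act_append M_def)
    also have "\<dots> = (cen ^^ negs u) (push s ((cen ^^ negs v) (push t M)))"
      by (simp add: add.commute flip: cen_pow_add cen_pow_push)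
    also have "\<dots> = (cen ^^ negs v) ((cen ^^ negs (u @ inverse_word v)) (push s L))"
      unfolding * by (simp add: ac_simps flip: cen_pow_push cen_pow_add)
    finally show "(cen ^^ negs v) (act (u @ inverse_word v) L) =
        (cen ^^ negs v) ((cen ^^ negs (u @ inverse_word v)) (push s L))" .
  qed (simp_all add: L good_act good_cen_pow good_push)
  ultimately have "represents (u @ inverse_word v) s"
    using words by (simp add: represents_def)
  then show ?case by blast
qed

lemma ex_word:
  "\<exists>w\<in>artin_words n. foldr (\<lambda>s x. ev s \<otimes>\<^bsub>braid_group n\<^esub> x) u \<one>\<^bsub>braid_group n\<^esub> = cls n w \<and>
    act w [] = (cen ^^ negs w) (nf u)"
proof (induction u)
  case Nil
  show ?case by (rule bexI[of _ "[]"]) (simp_all add: cls_Nil nf_def)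
next
  case (Cons s u)
  then obtain w where w: "w \<in> artin_words n"
    "foldr (\<lambda>s x. ev s \<otimes>\<^bsub>braid_group n\<^esub> x) u \<one>\<^bsub>braid_group n\<^esub> = cls n w"
    "act w [] = (cen ^^ negs w) (nf u)" by blast
  obtain v where v: "represents v s" using ex_represents by blast
  have "act (v @ w) [] = (cen ^^ negs (v @ w)) (nf (s # u))"
    using v good_cen_pow[OF good_nf, of "negs w" u]
    by (simp add: act_append represents_def w(3) cen_pow_add nf_def) (simp add: cen_pow_push)
  then show ?case
    using v w by (intro bexI[of _ "v @ w"]) (simp_all add: represents_def mult_class_artin_rel)
qed

text \<open>Words for the two values are related, so their actions on the empty list agree up to
  \<open>cen\<close>; these actions are the normal forms, again up to \<open>cen\<close>, which is
  injective.\<close>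

lemma nf_faithful:
  assumes "foldr (\<lambda>s x. ev s \<otimes>\<^bsub>braid_group n\<^esub> x) u \<one>\<^bsub>braid_group n\<^esub> =
    foldr (\<lambda>s x. ev s \<otimes>\<^bsub>braid_group n\<^esub> x) v \<one>\<^bsub>braid_group n\<^esub>"
  shows "nf u = nf v"
proof -
  obtain w where w: "w \<in> artin_words n" "act w [] = (cen ^^ negs w) (nf u)"
    "foldr (\<lambda>s x. ev s \<otimes>\<^bsub>braid_group n\<^esub> x) u \<one>\<^bsub>braid_group n\<^esub> = cls n w"
    using ex_word by blast
  obtain w' where w': "w' \<in> artin_words n" "act w' [] = (cen ^^ negs w') (nf v)"
    "foldr (\<lambda>s x. ev s \<otimes>\<^bsub>braid_group n\<^esub> x) v \<one>\<^bsub>braid_group n\<^esub> = cls n w'"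
    using ex_word by blast
  have "(w, w') \<in> artin_rel n"
    using assms w w' cls_eq by auto
  from act_artin_rel[OF this good_Nil] have
    "(cen ^^ (negs w + negs w')) (nf u) = (cen ^^ (negs w + negs w')) (nf v)"
    using w(2) w'(2) by (simp add: add.commute flip: cen_pow_add)
  then show ?thesis using cen_pow_inj good_nf by blast
qed

lemma braid_deg_mult:
  "X \<in> carrier (braid_group n) \<Longrightarrow> Y \<in> carrier (braid_group n) \<Longrightarrow>
    braid_deg (X \<otimes>\<^bsub>braid_group n\<^esub> Y) = braid_deg X + braid_deg Y"
  by (auto simp: carrier_braid_group mult_class_artin_rel braid_deg_cls)

lemma braid_deg_ev: "braid_deg (ev s) = int (rank s)"
proof (induction rule: gen_induct)
  case 1
  show ?case using braid_deg_cls[of "[]" n] rank_eq_0[of one] by (simp add: ev_unit flip: cls_Nil)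
next
  case (2 i)
  then show ?case
    using braid_deg_cls[of "[(True, i)]" n] by (simp add: ev_gen rank_gen artin_gen_def artin_words_Cons)
next
  case (3 s t p)
  then show ?case
    using braid_deg_mult[OF ev_carrier ev_carrier, of s t] by (simp add: ev_hom rank_mul)
next
  case (4 s t p)
  then show ?case
    using braid_deg_mult[OF ev_carrier ev_carrier, of s t] by (simp add: ev_hom rank_mul)
qed

lemma braid_generated:
  assumes "\<one>\<^bsub>braid_group n\<^esub> \<in> S" "\<And>s x. x \<in> S \<Longrightarrow> ev s \<otimes>\<^bsub>braid_group n\<^esub> x \<in> S"
    "\<And>s x. x \<in> S \<Longrightarrow> inv\<^bsub>braid_group n\<^esub> (ev s) \<otimes>\<^bsub>braid_group n\<^esub> x \<in> S"
  shows "carrier (braid_group n) \<subseteq> S"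
proof -
  have "cls n w \<in> S" if "w \<in> artin_words n" for w
    using that
  proof (induction w)
    case Nil
    then show ?case using assms(1) by (simp add: cls_Nil)
  next
    case (Cons x w)
    obtain b i where x: "x = (b, i)" by fastforce
    have i: "i \<in> {1..<n}" and w: "w \<in> artin_words n"
      using Cons.prems by (auto simp: x artin_words_Cons)
    have s: "[(True, i)] \<in> artin_words n" "[(False, i)] \<in> artin_words n"
      using i by (auto simp: artin_words_Cons)
    have "cls n (x # w) = (if b then ev (gen i) else inv\<^bsub>braid_group n\<^esub> ev (gen i)) \<otimes>\<^bsub>braid_group n\<^esub> cls n w"
      using s i w by (simp add: x ev_gen artin_gen_def cls_inverse inverse_word_def mult_class_artin_rel)
    then show ?case using Cons.IH[OF w] assms(2,3) by simp
  qed
  then show ?thesis by (auto simp: carrier_braid_group)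
qed

sublocale garside_group one top mul slide lc period rank "braid_group n" ev braid_deg
  by (intro garside_group.intro garside_group_axioms.intro germ_axioms group_braid_group)
    (fact ev_carrier ev_unit ev_hom braid_deg_mult braid_deg_ev nf_faithful braid_generated)+

section \<open>Band words and (almost) positive elements\<close>

lemma SQP_one: "\<one>\<^bsub>braid_group n\<^esub> \<in> SQP n"
  unfolding SQP_def
  by (intro CollectI exI[of _ "[]"]) (simp add: band_eval_def braid_prod_def band_words_def negative_bands_def)

lemma band_ev:
  assumes "1 \<le> i" "i < j" "j \<le> n"
  shows "\<exists>s. rank s = 1 \<and> band n i j = ev s"
proof -
  have "band n i j \<in> {ev s |s. rank s = 1}"
    unfolding ev_band using assms by blast
  then show ?thesis by blast
qed

lemma band_carrier: "1 \<le> i \<Longrightarrow> i < j \<Longrightarrow> j \<le> n \<Longrightarrow> band n i j \<in> carrier (braid_group n)"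
  using band_ev[of i j] ev_carrier by auto

lemma band_letter_carrier:
  "x \<in> {(b, i, j). 1 \<le> i \<and> i < j \<and> j \<le> n} \<Longrightarrow> band_letter n x \<in> carrier (braid_group n)"
  using band_carrier by auto

lemma band_eval_Cons [simp]:
  "band_eval n (x # w) = band_letter n x \<otimes>\<^bsub>braid_group n\<^esub> band_eval n w"
  by (simp add: band_eval_def braid_prod_def)

lemma band_eval_Nil [simp]: "band_eval n [] = \<one>\<^bsub>braid_group n\<^esub>"
  by (simp add: band_eval_def braid_prod_def)

lemma band_words_simps [simp]:
  "[] \<in> band_words n"
  "x # w \<in> band_words n \<longleftrightarrow> x \<in> {(b, i, j). 1 \<le> i \<and> i < j \<and> j \<le> n} \<and> w \<in> band_words n"
  "u @ v \<in> band_words n \<longleftrightarrow> u \<in> band_words n \<and> v \<in> band_words n"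
  by (auto simp: band_words_def)

lemma negative_bands_simps [simp]:
  "negative_bands [] = 0"
  "negative_bands ((b, i, j) # w) = (if b then negative_bands w else Suc (negative_bands w))"
  "negative_bands (u @ v) = negative_bands u + negative_bands v"
  by (auto simp: negative_bands_def)

lemma band_eval_carrier: "w \<in> band_words n \<Longrightarrow> band_eval n w \<in> carrier (braid_group n)"
  by (induction w) (auto simp del: band_letter.simps intro!: m_closed band_letter_carrier)

lemma band_eval_append:
  "u \<in> band_words n \<Longrightarrow> v \<in> band_words n \<Longrightarrow>
    band_eval n (u @ v) = band_eval n u \<otimes>\<^bsub>braid_group n\<^esub> band_eval n v"
  by (induction u) (auto simp: band_eval_carrier m_assoc band_letter_carrier simp del: band_letter.simps)

lemma ev_rank1:
  assumes "rank s = 1"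
  shows "\<exists>i j. 1 \<le> i \<and> i < j \<and> j \<le> n \<and> ev s = band n i j"
proof -
  have "ev s \<in> {ev s |s. rank s = 1}" using assms by blast
  then show ?thesis unfolding ev_band by blast
qed

lemma SQP_ev: "ev s \<in> SQP n"
proof (induction "rank s" arbitrary: s rule: less_induct)
  case less
  consider "rank s = 0" | "rank s = 1" | "1 < rank s" by linarith
  then show ?case
  proof cases
    case 1
    then show ?thesis using SQP_one by (simp add: rank_eq_0)
  next
    case 2
    then obtain i j where ij: "1 \<le> i" "i < j" "j \<le> n" "ev s = band n i j"
      using ev_rank1 by blast
    then show ?thesis
      unfolding SQP_def using band_carrier
      by (intro CollectI exI[of _ "[(True, i, j)]"]) simp
  next
    case 3
    then obtain t u where tu: "mul t u = Some s" "rank t = 1"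
      using rank_decomp by blast
    then obtain i j where ij: "1 \<le> i" "i < j" "j \<le> n" "ev t = band n i j"
      using ev_rank1 by blast
    obtain w where w: "w \<in> band_words n" "negative_bands w = 0" "ev u = band_eval n w"
      using less[of u] rank_mul[OF tu(1)] tu(2) by (auto simp: SQP_def)
    have "ev s = band_eval n ((True, i, j) # w)"
      using ev_hom[OF tu(1)] ij w by simp
    then show ?thesis
      unfolding SQP_def using ij w by (intro CollectI exI[of _ "(True, i, j) # w"]) simp
  qed
qed

lemma SQP_mult: "x \<in> SQP n \<Longrightarrow> y \<in> SQP n \<Longrightarrow> x \<otimes>\<^bsub>braid_group n\<^esub> y \<in> SQP n"
  unfolding SQP_def by clarsimp (metis band_eval_append band_words_simps(3) negative_bands_simps(3) add_0)

lemma band_eval_Pos: "w \<in> band_words n \<Longrightarrow> negative_bands w = 0 \<Longrightarrow> band_eval n w \<in> Pos"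
proof (induction w)
  case (Cons x w)
  obtain i j where x: "x = (True, i, j)" "1 \<le> i" "i < j" "j \<le> n"
    using Cons.prems by (cases x) (auto split: if_splits)
  then obtain s where "band n i j = ev s" using band_ev by blast
  with x Cons show ?case by (simp add: Pos_mult ev_Pos)
qed (simp add: one_Pos)

lemma SQP_eq: "SQP n = Pos"
proof
  show "SQP n \<subseteq> Pos" using band_eval_Pos by (auto simp: SQP_def)
  have "eval u \<in> SQP n" for u
    by (induction u) (simp_all add: SQP_one SQP_ev SQP_mult)
  then show "Pos \<subseteq> SQP n" by (auto simp: Pos_def)
qed

lemma band_eval_APos: "w \<in> band_words n \<Longrightarrow> negative_bands w \<le> 1 \<Longrightarrow> band_eval n w \<in> APos"
proof (induction w)
  case Nil
  then show ?case using one_Pos by (simp add: APos_def)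
next
  case (Cons x w)
  obtain b i j where x: "x = (b, i, j)" "1 \<le> i" "i < j" "j \<le> n"
    using Cons.prems by (cases x) auto
  obtain s where s: "rank s = 1" "band n i j = ev s"
    using band_ev[OF x(2-4)] by blast
  show ?case
  proof (cases b)
    case True
    then have "band_eval n w \<in> APos" using Cons x by simp
    then consider "band_eval n w \<in> Pos" | P a Q where "P \<in> Pos" "Q \<in> Pos" "rank a = 1"
      "band_eval n w = P \<otimes>\<^bsub>braid_group n\<^esub> inv\<^bsub>braid_group n\<^esub> ev a \<otimes>\<^bsub>braid_group n\<^esub> Q"
      by (auto simp: APos_def)
    then show ?thesis
    proof cases
      case 1
      then show ?thesis using True x s by (simp add: APos_def Pos_mult ev_Pos)
    next
      case 2
      have "band_eval n (x # w) = (ev s \<otimes>\<^bsub>braid_group n\<^esub> P) \<otimes>\<^bsub>braid_group n\<^esub>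
          inv\<^bsub>braid_group n\<^esub> ev a \<otimes>\<^bsub>braid_group n\<^esub> Q"
        using 2 Pos_closed by (simp add: x s True m_assoc)
      moreover have "ev s \<otimes>\<^bsub>braid_group n\<^esub> P \<in> Pos" using 2 by (simp add: Pos_mult ev_Pos)
      ultimately show ?thesis using 2(2,3) unfolding APos_def by blast
    qed
  next
    case False
    then have "band_eval n w \<in> Pos" using Cons x band_eval_Pos by simp
    moreover have "band_eval n (x # w) = \<one>\<^bsub>braid_group n\<^esub> \<otimes>\<^bsub>braid_group n\<^esub>
        inv\<^bsub>braid_group n\<^esub> ev s \<otimes>\<^bsub>braid_group n\<^esub> band_eval n w"
      by (simp add: x s False)
    ultimately show ?thesis using s(1) one_Pos unfolding APos_def by blast
  qed
qed

lemma ASQP_eq: "ASQP n = APos"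
proof
  show "ASQP n \<subseteq> APos" using band_eval_APos by (auto simp: ASQP_def)
  show "APos \<subseteq> ASQP n"
  proof
    fix x assume "x \<in> APos"
    then consider "x \<in> SQP n" | P a Q where "P \<in> SQP n" "Q \<in> SQP n" "rank a = 1"
      "x = P \<otimes>\<^bsub>braid_group n\<^esub> inv\<^bsub>braid_group n\<^esub> ev a \<otimes>\<^bsub>braid_group n\<^esub> Q"
      by (auto simp: APos_def SQP_eq)
    then show "x \<in> ASQP n"
    proof cases
      case 1
      then show ?thesis by (auto simp: SQP_def ASQP_def)
    next
      case 2
      obtain u v where u: "u \<in> band_words n" "negative_bands u = 0" "P = band_eval n u"
        and v: "v \<in> band_words n" "negative_bands v = 0" "Q = band_eval n v"
        using 2 by (auto simp: SQP_def)
      obtain i j where ij: "1 \<le> i" "i < j" "j \<le> n" "ev a = band n i j"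
        using ev_rank1[OF 2(3)] by blast
      let ?w = "u @ (False, i, j) # v"
      have "x = band_eval n ?w"
        using u v ij by (simp add: 2 band_eval_append m_assoc band_eval_carrier band_carrier)
      then show ?thesis
        unfolding ASQP_def using u v ij by (intro CollectI exI[of _ ?w]) simp
    qed
  qed
qed

section \<open>Order, infimum, supremum and canonical forms in the abstract setting\<close>

lemma braid_le_eq: "braid_le n = le"
  by (simp add: fun_eq_iff braid_le_def le_def SQP_eq)

lemma braid_inf_eq: "braid_inf n = Inf"
  by (simp add: fun_eq_iff braid_inf_def Inf_def braid_le_eq ev_delta)

lemma braid_sup_eq: "braid_sup n = Sup"
  by (simp add: fun_eq_iff braid_sup_def Sup_def braid_le_eq ev_delta)

lemma conj_class_eq: "conj_class n = conjs"
  by (simp add: fun_eq_iff conj_class_def conjs_def)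

lemma super_summit_set_eq: "super_summit_set n = summit_set"
  by (simp add: fun_eq_iff super_summit_set_def summit_set_def conj_class_eq canonical_length_def
      braid_inf_eq braid_sup_eq)

lemma canonical_factors_eq: "canonical_factors n = range ev"
  using canonical_iff by (auto simp: canonical_factors_def braid_le_eq ev_delta)

lemma left_weighted_iff: "left_weighted n (ev s) (ev t) \<longleftrightarrow> slide s t = (s, t)"
proof
  assume lw: "left_weighted n (ev s) (ev t)"
  obtain b r where sl: "slide s t = (b, r)" by fastforce
  then obtain d where d: "mul s d = Some b" "mul d r = Some t"
    using slide_split by blast
  have "ev b = ev s \<otimes>\<^bsub>braid_group n\<^esub> ev d"
    using ev_hom[OF d(1)] by simp
  moreover have "ev s \<otimes>\<^bsub>braid_group n\<^esub> ev t = ev b \<otimes>\<^bsub>braid_group n\<^esub> ev r"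
    by (simp add: m_assoc flip: ev_hom[OF d(1)] ev_hom[OF d(2)])
  ultimately have "ev b = ev s"
    using lw unfolding left_weighted_def factor_prefix_def canonical_factors_eq by blast
  then show "slide s t = (s, t)" using ev_inj sl slide_fixed by blast
next
  assume "slide s t = (s, t)"
  then show "left_weighted n (ev s) (ev t)"
    unfolding left_weighted_def factor_prefix_def canonical_factors_eq
    using greedy_maximal by blast
qed

lemma left_canonical_form_iff:
  "left_canonical_form n \<beta> r As \<longleftrightarrow> (\<exists>us. As = map ev us \<and>
    \<beta> = ev top [^]\<^bsub>braid_group n\<^esub> r \<otimes>\<^bsub>braid_group n\<^esub> eval us \<and> set us \<subseteq> - {one, top} \<and>
    (\<forall>i. Suc i < length us \<longrightarrow> slide (us ! i) (us ! Suc i) = (us ! i, us ! Suc i)))"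
proof -
  have sub: "set (map ev us) \<subseteq> range ev - {\<one>\<^bsub>braid_group n\<^esub>, ev top} \<longleftrightarrow>
      set us \<subseteq> - {one, top}" for us
    using ev_inj by (fastforce simp flip: ev_unit)
  have "left_canonical_form n \<beta> r (map ev us) \<longleftrightarrow>
      \<beta> = ev top [^]\<^bsub>braid_group n\<^esub> r \<otimes>\<^bsub>braid_group n\<^esub> eval us \<and> set us \<subseteq> - {one, top} \<and>
      (\<forall>i. Suc i < length us \<longrightarrow> slide (us ! i) (us ! Suc i) = (us ! i, us ! Suc i))" for us
    unfolding left_canonical_form_def canonical_factors_eq ev_delta[symmetric] sub
    by (simp add: braid_prod_def eval_def foldr_map comp_def left_weighted_iff)
  moreover have "\<exists>us. As = map ev us" if "left_canonical_form n \<beta> r As"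
    using that by (auto simp: left_canonical_form_def canonical_factors_eq ex_map_conv)
  ultimately show ?thesis by blast
qed

lemma braid_deg_band_eval:
  "w \<in> band_words n \<Longrightarrow> braid_deg (band_eval n w) = int (length w) - 2 * int (negative_bands w)"
proof (induction w)
  case (Cons x w)
  obtain b i j where x: "x = (b, i, j)" "1 \<le> i" "i < j" "j \<le> n"
    using Cons.prems by (cases x) auto
  obtain s where s: "rank s = 1" "band n i j = ev s"
    using band_ev[OF x(2-4)] by blast
  show ?case
    using Cons x s by (simp add: braid_deg_mult band_eval_carrier deg_inv deg_ev)
qed (simp add: deg_one)

text \<open>The exponent sum bounds the length of any band word from below, and a positive word
  attains the bound.\<close>

lemma band_length_ev: "band_length n (ev s) = rank s"
  unfolding band_length_def
proof (rule Least_equality)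
  obtain w where w: "w \<in> band_words n" "negative_bands w = 0" "ev s = band_eval n w"
    using SQP_ev[of s] by (auto simp: SQP_def)
  then have "length w = rank s"
    using braid_deg_band_eval[OF w(1)] deg_ev[of s] by simp
  then show "\<exists>w\<in>band_words n. band_eval n w = ev s \<and> length w = rank s"
    using w by auto
next
  fix m assume "\<exists>w\<in>band_words n. band_eval n w = ev s \<and> length w = m"
  then show "rank s \<le> m"
    using braid_deg_band_eval deg_ev[of s] by fastforce
qed

lemma conj_iff: "conj_ASQP n \<beta> \<and> \<not> conj_SQP n \<beta> \<longleftrightarrow> conjs \<beta> \<inter> APos \<noteq> {} \<and> conjs \<beta> \<inter> Pos = {}"
  by (simp add: conj_ASQP_def conj_SQP_def conj_class_eq ASQP_eq SQP_eq)

theorem conj_ASQP_iff_rank2: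
  assumes "rank top = 2" "\<beta> \<in> carrier (braid_group n)"
    "\<beta> \<notin> conj_class n (inv\<^bsub>braid_group n\<^esub> delta n)"
  shows "conj_ASQP n \<beta> \<and> \<not> conj_SQP n \<beta> \<longleftrightarrow>
    (\<forall>\<beta>'\<in>super_summit_set n \<beta>. braid_inf n \<beta>' = -1)"
  using assms APos_iff_rank2[of \<beta>] unfolding conj_iff super_summit_set_eq braid_inf_eq
  by (simp add: conj_class_eq int_pow_neg flip: ev_delta)

theorem conj_ASQP_iff_rank3:
  assumes "rank top = 3" "\<beta> \<in> carrier (braid_group n)"
  shows "conj_ASQP n \<beta> \<and> \<not> conj_SQP n \<beta> \<longleftrightarrow>
    (\<forall>\<beta>'\<in>super_summit_set n \<beta>. braid_inf n \<beta>' = -1 \<and>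
      (\<exists>As. left_canonical_form n \<beta>' (-1) As \<and> (\<exists>A\<in>set As. band_length n A = 2)))"
proof -
  have ex_map: "(\<exists>As. (\<exists>us. As = map ev us \<and> F us) \<and> H As) \<longleftrightarrow> (\<exists>us. F us \<and> H (map ev us))" for F H
    by blast
  have "(\<exists>As. left_canonical_form n y (-1) As \<and> (\<exists>A\<in>set As. band_length n A = 2)) \<longleftrightarrow>
      (\<exists>us. y = ev top [^]\<^bsub>braid_group n\<^esub> (- 1 :: int) \<otimes>\<^bsub>braid_group n\<^esub> eval us \<and> set us \<subseteq> - {one, top} \<and>
        (\<forall>i. Suc i < length us \<longrightarrow> slide (us ! i) (us ! Suc i) = (us ! i, us ! Suc i)) \<and>
        (\<exists>s\<in>set us. rank s = 2))" for y
    unfolding left_canonical_form_iff ex_map by (simp add: band_length_ev conj_assoc)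
  then show ?thesis
    using APos_iff_rank3[OF assms(2,1)] unfolding conj_iff super_summit_set_eq braid_inf_eq by simp
qed

end

section \<open>Noncrossing partitions of three and four points\<close>

text \<open>
  The canonical factors are indexed by the noncrossing partitions of the strands; the name of a
  factor lists the blocks with more than one element.  The tables omit the trivial entries:
  products with the unit, and slides in which \<open>t\<close> is absorbed entirely or not at all.
\<close>

definition table_mul :: "'f \<Rightarrow> (('f \<times> 'f) \<times> 'f) list \<Rightarrow> 'f \<Rightarrow> 'f \<Rightarrow> 'f option" where
  "table_mul e T s t = (if s = e then Some t else if t = e then Some s else map_of T (s, t))"

definition table_slide ::
    "'f \<Rightarrow> (('f \<times> 'f) \<times> 'f) list \<Rightarrow> (('f \<times> 'f) \<times> 'f \<times> 'f) list \<Rightarrow> 'f \<Rightarrow> 'f \<Rightarrow> 'f \<times> 'f" where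
  "table_slide e T S s t = (case table_mul e T s t of Some p \<Rightarrow> (p, e)
    | None \<Rightarrow> (case map_of S (s, t) of Some br \<Rightarrow> br | None \<Rightarrow> (s, t)))"

text \<open>The checks restate germ axioms with quantifiers over a list, so that evaluation can
  decide them.\<close>

definition split_check ::
    "'f \<Rightarrow> 'f list \<Rightarrow> (('f \<times> 'f) \<times> 'f) list \<Rightarrow> (('f \<times> 'f) \<times> 'f \<times> 'f) list \<Rightarrow> bool" where
  "split_check e F T S \<longleftrightarrow> (\<forall>s\<in>set F. \<forall>t\<in>set F. case table_slide e T S s t of (b, r) \<Rightarrow>
    \<exists>d\<in>set F. table_mul e T s d = Some b \<and> table_mul e T d r = Some t)"

definition slide_check ::
    "'f \<Rightarrow> 'f list \<Rightarrow> (('f \<times> 'f) \<times> 'f) list \<Rightarrow> (('f \<times> 'f) \<times> 'f \<times> 'f) list \<Rightarrow> bool" where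
  "slide_check e F T S \<longleftrightarrow> (\<forall>s\<in>set F. \<forall>t\<in>set F. case table_mul e T s t of None \<Rightarrow> True
    | Some p \<Rightarrow> (\<forall>u\<in>set F. case table_slide e T S t u of (b, r) \<Rightarrow>
        case table_slide e T S s b of (c, q) \<Rightarrow> case table_mul e T q r of None \<Rightarrow> False
        | Some x \<Rightarrow> table_slide e T S p u = (c, x)))"

definition rank_check ::
    "'f \<Rightarrow> 'f list \<Rightarrow> (('f \<times> 'f) \<times> 'f) list \<Rightarrow> (('f \<times> 'f) \<times> 'f \<times> 'f) list \<Rightarrow> 'f \<Rightarrow>
      ('f \<Rightarrow> 'f) \<Rightarrow> nat \<Rightarrow> ('f \<Rightarrow> nat) \<Rightarrow> bool" where
  "rank_check e F T S w lc m rank \<longleftrightarrow> list_all (\<lambda>((s, t), p). rank p = rank s + rank t) T \<and>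
    (\<forall>s\<in>set F. table_slide e T S w s = (w, s) \<and> table_mul e T (lc s) s = Some w \<and>
      ((lc \<circ> lc) ^^ m) s = s \<and> (rank s = 0 \<longleftrightarrow> s = e))"

lemma germ_table:
  assumes F: "set F = UNIV" and checks: "split_check e F T S" "slide_check e F T S"
    "rank_check e F T S w lc m rank" and ne: "w \<noteq> e" "0 < m"
  shows "germ e w (table_mul e T) (table_slide e T S) lc m rank"
proof
  fix s t u p b r c q
  show "table_mul e T e s = Some s" "table_mul e T s e = Some s"
    by (simp_all add: table_mul_def)
  show "\<exists>d. table_mul e T s d = Some b \<and> table_mul e T d r = Some t"
    if "table_slide e T S s t = (b, r)"
  proof -
    have "case table_slide e T S s t of (b, r) \<Rightarrow>
        \<exists>d\<in>UNIV. table_mul e T s d = Some b \<and> table_mul e T d r = Some t"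
      using checks(1)[unfolded split_check_def F, THEN bspec, OF UNIV_I, THEN bspec, OF UNIV_I] .
    then show ?thesis using that by simp
  qed
  show "table_slide e T S s t = (p, e)" if "table_mul e T s t = Some p"
    using that by (simp add: table_slide_def)
  show "\<exists>x. table_mul e T q r = Some x \<and> table_slide e T S p u = (c, x)"
    if st: "table_mul e T s t = Some p" "table_slide e T S t u = (b, r)" "table_slide e T S s b = (c, q)"
  proof -
    have "case table_mul e T s t of None \<Rightarrow> True
      | Some p \<Rightarrow> (\<forall>u\<in>UNIV. case table_slide e T S t u of (b, r) \<Rightarrow>
        case table_slide e T S s b of (c, q) \<Rightarrow> case table_mul e T q r of None \<Rightarrow> False
        | Some x \<Rightarrow> table_slide e T S p u = (c, x))"
      using checks(2) unfolding slide_check_def F by blast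
    from this[unfolded st(1) option.case, rule_format, of u] show ?thesis
      using st(2,3) by (auto split: option.splits)
  qed
  have rank: "table_slide e T S w s = (w, s) \<and> table_mul e T (lc s) s = Some w \<and>
      ((lc \<circ> lc) ^^ m) s = s \<and> (rank s = 0 \<longleftrightarrow> s = e)" for s
    using checks(3)[unfolded rank_check_def F, THEN conjunct2, THEN bspec, OF UNIV_I] .
  show "table_slide e T S w t = (w, t)" "table_mul e T (lc s) s = Some w"
    "((lc \<circ> lc) ^^ m) s = s" "rank s = 0 \<longleftrightarrow> s = e"
    using rank by simp_all
  \<comment> \<open>The check covers only the entries of \<open>T\<close>; products with the unit
    need \<open>rank e = 0\<close>.\<close>
  show "rank p = rank s + rank t" if "table_mul e T s t = Some p"
    using that checks(3) rank[of e] unfolding rank_check_def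
    by (auto simp: table_mul_def list_all_iff dest!: map_of_SomeD split: if_splits)
qed (use ne in auto)

datatype nc3 =
  N1 | N12 | N13 | N23 | N123

definition nc3_elems :: "nc3 list" where
  "nc3_elems =
    [N1, N12, N13, N23, N123]"

definition nc3_products :: "((nc3 \<times> nc3) \<times> nc3) list" where
  "nc3_products =
    [((N12,N13),N123), ((N13,N23),N123), ((N23,N12),N123)]"

definition nc3_slides :: "((nc3 \<times> nc3) \<times> nc3 \<times> nc3) list" where
  "nc3_slides =
    [((N12,N123),(N123,N23)), ((N13,N123),(N123,N12)), ((N23,N123),(N123,N13))]"

text \<open>A Kreweras complement. Its square moves every strand down by one cyclically, whence the
  period 3.\<close>

fun nc3_compl :: "nc3 \<Rightarrow> nc3" where
  "nc3_compl N1 = N123"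
| "nc3_compl N12 = N23"
| "nc3_compl N13 = N12"
| "nc3_compl N23 = N13"
| "nc3_compl N123 = N1"

text \<open>The number of strands minus the number of blocks.\<close>

fun nc3_rank :: "nc3 \<Rightarrow> nat" where
  "nc3_rank N1 = 0"
| "nc3_rank N12 = 1"
| "nc3_rank N13 = 1"
| "nc3_rank N23 = 1"
| "nc3_rank N123 = 2"

datatype nc4 =
  P1 | P12 | P13 | P14 | P23 | P24 | P34 | P123 | P124 | P12_34 | P134 | P14_23 | P234 | P1234

definition nc4_elems :: "nc4 list" where
  "nc4_elems =
    [P1, P12, P13, P14, P23, P24, P34, P123, P124, P12_34, P134, P14_23, P234, P1234]"

definition nc4_products :: "((nc4 \<times> nc4) \<times> nc4) list" where
  "nc4_products =
    [((P12,P13),P123), ((P12,P14),P124), ((P12,P34),P12_34), ((P12,P134),P1234),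
    ((P13,P14),P134), ((P13,P23),P123), ((P13,P14_23),P1234), ((P14,P23),P14_23),
    ((P14,P24),P124), ((P14,P34),P134), ((P14,P234),P1234), ((P23,P12),P123),
    ((P23,P14),P14_23), ((P23,P24),P234), ((P23,P124),P1234), ((P24,P12),P124),
    ((P24,P34),P234), ((P24,P12_34),P1234), ((P34,P12),P12_34), ((P34,P13),P134),
    ((P34,P23),P234), ((P34,P123),P1234), ((P123,P14),P1234), ((P124,P34),P1234),
    ((P12_34,P13),P1234), ((P134,P23),P1234), ((P14_23,P24),P1234), ((P234,P12),P1234)]"

definition nc4_slides :: "((nc4 \<times> nc4) \<times> nc4 \<times> nc4) list" where
  "nc4_slides =
    [((P12,P123),(P123,P23)), ((P12,P124),(P124,P24)), ((P12,P12_34),(P12_34,P12)),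
    ((P12,P14_23),(P124,P23)), ((P12,P234),(P12_34,P23)), ((P12,P1234),(P1234,P23)),
    ((P13,P123),(P123,P12)), ((P13,P124),(P134,P24)), ((P13,P134),(P134,P34)),
    ((P13,P234),(P123,P24)), ((P13,P1234),(P1234,P24)), ((P14,P123),(P14_23,P12)),
    ((P14,P124),(P124,P12)), ((P14,P12_34),(P134,P12)), ((P14,P134),(P134,P13)),
    ((P14,P14_23),(P14_23,P14)), ((P14,P1234),(P1234,P12)), ((P23,P123),(P123,P13)),
    ((P23,P12_34),(P123,P34)), ((P23,P134),(P14_23,P34)), ((P23,P14_23),(P14_23,P23)),
    ((P23,P234),(P234,P34)), ((P23,P1234),(P1234,P34)), ((P24,P123),(P124,P13)),
    ((P24,P124),(P124,P14)), ((P24,P134),(P234,P13)), ((P24,P234),(P234,P23)),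
    ((P24,P1234),(P1234,P13)), ((P34,P124),(P12_34,P14)), ((P34,P12_34),(P12_34,P34)),
    ((P34,P134),(P134,P14)), ((P34,P14_23),(P234,P14)), ((P34,P234),(P234,P24)),
    ((P34,P1234),(P1234,P14)), ((P123,P124),(P1234,P24)), ((P123,P134),(P1234,P34)),
    ((P123,P14_23),(P1234,P23)), ((P123,P1234),(P1234,P234)), ((P124,P12_34),(P1234,P12)),
    ((P124,P134),(P1234,P13)), ((P124,P234),(P1234,P23)), ((P124,P1234),(P1234,P123)),
    ((P12_34,P123),(P1234,P23)), ((P12_34,P134),(P1234,P14)), ((P12_34,P1234),(P1234,P14_23)),
    ((P134,P123),(P1234,P12)), ((P134,P14_23),(P1234,P14)), ((P134,P234),(P1234,P24)),
    ((P134,P1234),(P1234,P124)), ((P14_23,P124),(P1234,P12)), ((P14_23,P234),(P1234,P34)),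
    ((P14_23,P1234),(P1234,P12_34)), ((P234,P123),(P1234,P13)), ((P234,P124),(P1234,P14)),
    ((P234,P12_34),(P1234,P34)), ((P234,P1234),(P1234,P134))]"

text \<open>Again a Kreweras complement; its square rotates the four strands, whence the period
  4.\<close>

fun nc4_compl :: "nc4 \<Rightarrow> nc4" where
  "nc4_compl P1 = P1234"
| "nc4_compl P12 = P234"
| "nc4_compl P13 = P12_34"
| "nc4_compl P14 = P123"
| "nc4_compl P23 = P134"
| "nc4_compl P24 = P14_23"
| "nc4_compl P34 = P124"
| "nc4_compl P123 = P34"
| "nc4_compl P124 = P23"
| "nc4_compl P12_34 = P24"
| "nc4_compl P134 = P12"
| "nc4_compl P14_23 = P13"
| "nc4_compl P234 = P14"
| "nc4_compl P1234 = P1"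

fun nc4_rank :: "nc4 \<Rightarrow> nat" where
  "nc4_rank P1 = 0"
| "nc4_rank P12 = 1"
| "nc4_rank P13 = 1"
| "nc4_rank P14 = 1"
| "nc4_rank P23 = 1"
| "nc4_rank P24 = 1"
| "nc4_rank P34 = 1"
| "nc4_rank P123 = 2"
| "nc4_rank P124 = 2"
| "nc4_rank P12_34 = 2"
| "nc4_rank P134 = 2"
| "nc4_rank P14_23 = 2"
| "nc4_rank P234 = 2"
| "nc4_rank P1234 = 3"

interpretation nc3: germ N1 N123 "table_mul N1 nc3_products" "table_slide N1 nc3_products nc3_slides"
  nc3_compl 3 nc3_rank
proof (rule germ_table[where F = nc3_elems])
  show "set nc3_elems = UNIV"
    unfolding nc3_elems_def by (auto intro: nc3.exhaust)
  show "split_check N1 nc3_elems nc3_products nc3_slides" by code_simp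
  show "slide_check N1 nc3_elems nc3_products nc3_slides" by code_simp
  show "rank_check N1 nc3_elems nc3_products nc3_slides N123 nc3_compl 3 nc3_rank" by code_simp
qed simp_all

interpretation nc4: germ P1 P1234 "table_mul P1 nc4_products" "table_slide P1 nc4_products nc4_slides"
  nc4_compl 4 nc4_rank
proof (rule germ_table[where F = nc4_elems])
  show "set nc4_elems = UNIV"
    unfolding nc4_elems_def by (auto intro: nc4.exhaust)
  show "split_check P1 nc4_elems nc4_products nc4_slides" by code_simp
  show "slide_check P1 nc4_elems nc4_products nc4_slides" by code_simp
  show "rank_check P1 nc4_elems nc4_products nc4_slides P1234 nc4_compl 4 nc4_rank" by code_simp
qed simp_all

section \<open>The band relations\<close>

context group
begin

text \<open>Cancelling one \<open>y\<close> in the braid relation turns it into the dual relations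
  of a triangle of bands.\<close>

lemma braid_mult:
  assumes "x \<in> carrier G" "y \<in> carrier G" "x \<otimes> y \<otimes> x = y \<otimes> x \<otimes> y"
  shows "x \<otimes> (y \<otimes> x \<otimes> inv y) = y \<otimes> x" "(y \<otimes> x \<otimes> inv y) \<otimes> y = y \<otimes> x"
proof -
  have "x \<otimes> (y \<otimes> x \<otimes> inv y) = (x \<otimes> y \<otimes> x) \<otimes> inv y"
    using assms(1,2) by (simp add: m_assoc)
  then show "x \<otimes> (y \<otimes> x \<otimes> inv y) = y \<otimes> x"
    using assms(1,2) by (simp add: assms(3) m_assoc)
  show "(y \<otimes> x \<otimes> inv y) \<otimes> y = y \<otimes> x"
    using assms(1,2) by (simp add: m_assoc)
qed

lemma conj_mult:
  "g \<in> carrier G \<Longrightarrow> x \<in> carrier G \<Longrightarrow> y \<in> carrier G \<Longrightarrow>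
    (g \<otimes> x \<otimes> inv g) \<otimes> (g \<otimes> y \<otimes> inv g) = g \<otimes> (x \<otimes> y) \<otimes> inv g"
  by (simp add: m_assoc) (simp flip: m_assoc)

lemma braid_conj:
  assumes "g \<in> carrier G" "x \<in> carrier G" "y \<in> carrier G" "x \<otimes> y \<otimes> x = y \<otimes> x \<otimes> y"
    and "x' = g \<otimes> x \<otimes> inv g" "y' = g \<otimes> y \<otimes> inv g"
  shows "x' \<otimes> y' \<otimes> x' = y' \<otimes> x' \<otimes> y'"
  using assms(1-4) unfolding assms(5,6) by (simp only: conj_mult m_closed)

lemma commute_conj:
  "g \<in> carrier G \<Longrightarrow> x \<in> carrier G \<Longrightarrow> g \<otimes> x = x \<otimes> g \<Longrightarrow> g \<otimes> x \<otimes> inv g = x"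
  by (simp add: m_assoc)

text \<open>Here x, y, z, u, v, w are the bands 12, 23, 34, 13, 24, 14. Each triangle needs one
  braid relation: conjugation by z fixes x and takes (x, y) to (x, v); conjugation by y takes (x, v)
  to (u, z). Writing w as a conjugate of u by z and of x by v serves the two triangles containing
  it.\<close>

lemma band_relations4:
  fixes x y z
  defines "u \<equiv> y \<otimes> x \<otimes> inv y" and "v \<equiv> z \<otimes> y \<otimes> inv z"
    and "w \<equiv> z \<otimes> y \<otimes> x \<otimes> inv (z \<otimes> y)"
  assumes c [simp]: "x \<in> carrier G" "y \<in> carrier G" "z \<in> carrier G"
    and xy: "x \<otimes> y \<otimes> x = y \<otimes> x \<otimes> y" and yz: "y \<otimes> z \<otimes> y = z \<otimes> y \<otimes> z"
    and xz: "x \<otimes> z = z \<otimes> x"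
  shows "x \<otimes> u = y \<otimes> x" "u \<otimes> y = y \<otimes> x" "y \<otimes> v = z \<otimes> y" "v \<otimes> z = z \<otimes> y"
    "u \<otimes> w = z \<otimes> u" "w \<otimes> z = z \<otimes> u" "x \<otimes> w = v \<otimes> x" "w \<otimes> v = v \<otimes> x"
    "w \<otimes> y = y \<otimes> w"
proof -
  have uvw [simp]: "u \<in> carrier G" "v \<in> carrier G" "w \<in> carrier G"
    by (simp_all add: u_def v_def w_def)
  show "x \<otimes> u = y \<otimes> x" "u \<otimes> y = y \<otimes> x"
    unfolding u_def using braid_mult[of x y] xy by auto
  show yv: "y \<otimes> v = z \<otimes> y" and "v \<otimes> z = z \<otimes> y"
    unfolding v_def using braid_mult[of y z] yz by auto
  have xc: "x = z \<otimes> x \<otimes> inv z"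
    using commute_conj[of z x] xz by simp
  have xv: "x \<otimes> v \<otimes> x = v \<otimes> x \<otimes> v"
    using braid_conj[OF c(3,1,2) xy xc] by (simp add: v_def)
  have zc: "z = y \<otimes> v \<otimes> inv y"
    using yv by (simp add: m_assoc)
  have uz: "u \<otimes> z \<otimes> u = z \<otimes> u \<otimes> z"
    using braid_conj[OF c(2,1) uvw(2) xv _ zc] by (simp add: u_def)
  have w1: "w = z \<otimes> u \<otimes> inv z"
    by (simp add: w_def u_def inv_mult_group m_assoc)
  have "w = (z \<otimes> y \<otimes> inv z) \<otimes> (z \<otimes> x \<otimes> inv z) \<otimes> (z \<otimes> inv y \<otimes> inv z)"
    unfolding conj_mult[OF c(3) c(2) c(1)]
    by (simp add: w_def inv_mult_group m_assoc) (simp flip: m_assoc)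
  then have w2: "w = v \<otimes> x \<otimes> inv v"
    using xc by (simp add: v_def inv_mult_group m_assoc)
  show "u \<otimes> w = z \<otimes> u" "w \<otimes> z = z \<otimes> u"
    unfolding w1 using braid_mult[of u z] uz by auto
  show "x \<otimes> w = v \<otimes> x" "w \<otimes> v = v \<otimes> x"
    unfolding w2 using braid_mult[of x v] xv by auto
  \<comment> \<open>Conjugation by z y carries the commuting pair x, z to w, y.\<close>
  have "(z \<otimes> y) \<otimes> z \<otimes> inv (z \<otimes> y) = y \<otimes> ((z \<otimes> y) \<otimes> inv (z \<otimes> y))"
    unfolding yz[symmetric] by (simp add: m_assoc)
  then have yc: "y = (z \<otimes> y) \<otimes> z \<otimes> inv (z \<otimes> y)"
    by simp
  then have "w \<otimes> y = ((z \<otimes> y) \<otimes> x \<otimes> inv (z \<otimes> y)) \<otimes> ((z \<otimes> y) \<otimes> z \<otimes> inv (z \<otimes> y))"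
    unfolding w_def by simp
  also have "\<dots> = ((z \<otimes> y) \<otimes> z \<otimes> inv (z \<otimes> y)) \<otimes> ((z \<otimes> y) \<otimes> x \<otimes> inv (z \<otimes> y))"
    by (simp only: conj_mult m_closed c xz)
  also have "\<dots> = y \<otimes> w"
    using yc unfolding w_def by simp
  finally show "w \<otimes> y = y \<otimes> w" .
qed

end

lemma artin_gen_closed: "i \<in> {1..<n} \<Longrightarrow> artin_gen n i \<in> carrier (braid_group n)"
  by (simp add: artin_gen_def cls_closed artin_words_Cons)

lemma artin_gen_braid:
  "i \<in> {1..<n} \<Longrightarrow> Suc i \<in> {1..<n} \<Longrightarrow>
    artin_gen n i \<otimes>\<^bsub>braid_group n\<^esub> artin_gen n (Suc i) \<otimes>\<^bsub>braid_group n\<^esub> artin_gen n i =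
    artin_gen n (Suc i) \<otimes>\<^bsub>braid_group n\<^esub> artin_gen n i \<otimes>\<^bsub>braid_group n\<^esub> artin_gen n (Suc i)"
  using artin_rel.braid[of i n] by (simp add: artin_gen_def mult_class_artin_rel artin_words_Cons cls_eq)

lemma artin_gen_far:
  "i \<in> {1..<n} \<Longrightarrow> j \<in> {1..<n} \<Longrightarrow> i + 2 \<le> j \<Longrightarrow>
    artin_gen n i \<otimes>\<^bsub>braid_group n\<^esub> artin_gen n j = artin_gen n j \<otimes>\<^bsub>braid_group n\<^esub> artin_gen n i"
  using artin_rel.far[of i n j] by (simp add: artin_gen_def mult_class_artin_rel artin_words_Cons cls_eq)

lemma table_mul_hom:
  assumes "list_all (\<lambda>((s, t), p). f s \<otimes>\<^bsub>G\<^esub> f t = f p) T" "f e = \<one>\<^bsub>G\<^esub>" "group G"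
    and "\<And>s. f s \<in> carrier G" "table_mul e T s t = Some p"
  shows "f s \<otimes>\<^bsub>G\<^esub> f t = f p"
proof -
  interpret group G by fact
  show ?thesis
    using assms by (auto simp: table_mul_def list_all_iff dest!: map_of_SomeD split: if_splits)
qed

section \<open>The product tables hold in the braid groups\<close>

fun nc3_val :: "nc3 \<Rightarrow> artin_word set" where
  "nc3_val N1 = \<one>\<^bsub>braid_group 3\<^esub>"
| "nc3_val N12 = band 3 1 2"
| "nc3_val N13 = band 3 1 3"
| "nc3_val N23 = band 3 2 3"
| "nc3_val N123 = delta 3"

fun nc4_val :: "nc4 \<Rightarrow> artin_word set" where
  "nc4_val P1 = \<one>\<^bsub>braid_group 4\<^esub>"
| "nc4_val P12 = band 4 1 2"
| "nc4_val P13 = band 4 1 3"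
| "nc4_val P14 = band 4 1 4"
| "nc4_val P23 = band 4 2 3"
| "nc4_val P24 = band 4 2 4"
| "nc4_val P34 = band 4 3 4"
| "nc4_val P123 = band 4 2 3 \<otimes>\<^bsub>braid_group 4\<^esub> band 4 1 2"
| "nc4_val P124 = band 4 2 4 \<otimes>\<^bsub>braid_group 4\<^esub> band 4 1 2"
| "nc4_val P12_34 = band 4 3 4 \<otimes>\<^bsub>braid_group 4\<^esub> band 4 1 2"
| "nc4_val P134 = band 4 3 4 \<otimes>\<^bsub>braid_group 4\<^esub> band 4 1 3"
| "nc4_val P14_23 = band 4 2 3 \<otimes>\<^bsub>braid_group 4\<^esub> band 4 1 4"
| "nc4_val P234 = band 4 3 4 \<otimes>\<^bsub>braid_group 4\<^esub> band 4 2 3"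
| "nc4_val P1234 = delta 4"

lemma gen_desc_simps:
  "gen_desc n i i = \<one>\<^bsub>braid_group n\<^esub>"
  "i \<le> j \<Longrightarrow> gen_desc n i (Suc j) = artin_gen n j \<otimes>\<^bsub>braid_group n\<^esub> gen_desc n i j"
  by (simp_all add: gen_desc_def braid_prod_def)

lemma nc3_products_val:
  "list_all (\<lambda>((s, t), p). nc3_val s \<otimes>\<^bsub>braid_group 3\<^esub> nc3_val t = nc3_val p) nc3_products"
  and nc3_val_closed: "nc3_val s \<in> carrier (braid_group 3)"
  and nc3_val_gen: "nc3_val N12 = artin_gen 3 1" "nc3_val N23 = artin_gen 3 2"
proof -
  interpret group "braid_group 3" by (rule group_braid_group)
  let ?x = "artin_gen 3 1" and ?y = "artin_gen 3 2"
  have c [simp]: "?x \<in> carrier (braid_group 3)" "?y \<in> carrier (braid_group 3)"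
    by (simp_all add: artin_gen_closed)
  have xy: "?x \<otimes>\<^bsub>braid_group 3\<^esub> ?y \<otimes>\<^bsub>braid_group 3\<^esub> ?x =
      ?y \<otimes>\<^bsub>braid_group 3\<^esub> ?x \<otimes>\<^bsub>braid_group 3\<^esub> ?y"
    using artin_gen_braid[of 1 3] by (simp add: numeral_2_eq_2)
  have g: "gen_desc 3 2 3 = ?y" "gen_desc 3 1 2 = ?x"
    using gen_desc_simps(2)[of 2 2 3] gen_desc_simps(2)[of 1 1 3]
    by (simp_all add: gen_desc_simps(1) Suc_1 del: One_nat_def)
  have g2: "gen_desc 3 1 3 = ?y \<otimes>\<^bsub>braid_group 3\<^esub> ?x"
    using gen_desc_simps(2)[of 1 2 3] by (simp add: g del: One_nat_def)
  have b: "band 3 1 2 = ?x" "band 3 2 3 = ?y"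
    "band 3 1 3 = ?y \<otimes>\<^bsub>braid_group 3\<^esub> ?x \<otimes>\<^bsub>braid_group 3\<^esub> inv\<^bsub>braid_group 3\<^esub> ?y"
    "delta 3 = ?y \<otimes>\<^bsub>braid_group 3\<^esub> ?x"
    by (simp_all add: band_def delta_def gen_desc_simps(1) g g2 Suc_1 del: One_nat_def)
  show "list_all (\<lambda>((s, t), p). nc3_val s \<otimes>\<^bsub>braid_group 3\<^esub> nc3_val t = nc3_val p) nc3_products"
    using braid_mult[OF c xy] by (simp add: nc3_products_def b del: One_nat_def)
  show "nc3_val s \<in> carrier (braid_group 3)"
    by (cases s) (simp_all add: b del: One_nat_def)
  show "nc3_val N12 = ?x" "nc3_val N23 = ?y"
    by (simp_all add: b del: One_nat_def)
qed

lemma nc4_products_val: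
  "list_all (\<lambda>((s, t), p). nc4_val s \<otimes>\<^bsub>braid_group 4\<^esub> nc4_val t = nc4_val p) nc4_products"
  and nc4_val_closed: "nc4_val s \<in> carrier (braid_group 4)"
  and nc4_val_gen: "nc4_val P12 = artin_gen 4 1" "nc4_val P23 = artin_gen 4 2"
    "nc4_val P34 = artin_gen 4 3"
proof -
  interpret group "braid_group 4" by (rule group_braid_group)
  define x y z where "x = artin_gen 4 1" and "y = artin_gen 4 2" and "z = artin_gen 4 3"
  define u v w where "u = y \<otimes>\<^bsub>braid_group 4\<^esub> x \<otimes>\<^bsub>braid_group 4\<^esub> inv\<^bsub>braid_group 4\<^esub> y"
    and "v = z \<otimes>\<^bsub>braid_group 4\<^esub> y \<otimes>\<^bsub>braid_group 4\<^esub> inv\<^bsub>braid_group 4\<^esub> z"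
    and "w = z \<otimes>\<^bsub>braid_group 4\<^esub> y \<otimes>\<^bsub>braid_group 4\<^esub> x \<otimes>\<^bsub>braid_group 4\<^esub>
      inv\<^bsub>braid_group 4\<^esub> (z \<otimes>\<^bsub>braid_group 4\<^esub> y)"
  have c [simp]: "x \<in> carrier (braid_group 4)" "y \<in> carrier (braid_group 4)"
    "z \<in> carrier (braid_group 4)"
    by (simp_all add: x_def y_def z_def artin_gen_closed)
  then have cu [simp]: "u \<in> carrier (braid_group 4)" "v \<in> carrier (braid_group 4)"
    "w \<in> carrier (braid_group 4)"
    by (simp_all add: u_def v_def w_def)
  have xy: "x \<otimes>\<^bsub>braid_group 4\<^esub> y \<otimes>\<^bsub>braid_group 4\<^esub> x = y \<otimes>\<^bsub>braid_group 4\<^esub> x \<otimes>\<^bsub>braid_group 4\<^esub> y"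
    using artin_gen_braid[of 1 4] by (simp add: x_def y_def numeral_2_eq_2)
  have yz: "y \<otimes>\<^bsub>braid_group 4\<^esub> z \<otimes>\<^bsub>braid_group 4\<^esub> y = z \<otimes>\<^bsub>braid_group 4\<^esub> y \<otimes>\<^bsub>braid_group 4\<^esub> z"
    using artin_gen_braid[of 2 4] by (simp add: y_def z_def)
  have xz: "x \<otimes>\<^bsub>braid_group 4\<^esub> z = z \<otimes>\<^bsub>braid_group 4\<^esub> x"
    using artin_gen_far[of 1 4 3] by (simp add: x_def z_def)
  have gens: "artin_gen 4 1 = x" "artin_gen 4 2 = y" "artin_gen 4 3 = z"
    by (simp_all only: x_def y_def z_def)
  have g: "gen_desc 4 1 2 = x" "gen_desc 4 2 3 = y" "gen_desc 4 3 4 = z"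
    using gen_desc_simps(2)[of 1 1 4] gen_desc_simps(2)[of 2 2 4] gen_desc_simps(2)[of 3 3 4]
    by (simp_all add: gen_desc_simps(1) Suc_1 gens del: One_nat_def)
  have g2: "gen_desc 4 1 3 = y \<otimes>\<^bsub>braid_group 4\<^esub> x"
    "gen_desc 4 2 4 = z \<otimes>\<^bsub>braid_group 4\<^esub> y"
    using gen_desc_simps(2)[of 1 2 4] gen_desc_simps(2)[of 2 3 4]
    by (simp_all add: gens g del: One_nat_def)
  have g3: "gen_desc 4 1 4 = z \<otimes>\<^bsub>braid_group 4\<^esub> (y \<otimes>\<^bsub>braid_group 4\<^esub> x)"
    using gen_desc_simps(2)[of 1 3 4] by (simp add: gens g2 del: One_nat_def)
  have b: "band 4 1 2 = x" "band 4 2 3 = y" "band 4 3 4 = z" "band 4 1 3 = u" "band 4 2 4 = v"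
    "band 4 1 4 = w" "delta 4 = z \<otimes>\<^bsub>braid_group 4\<^esub> (y \<otimes>\<^bsub>braid_group 4\<^esub> x)"
    using gens by (simp_all add: band_def delta_def gen_desc_simps(1) g g2 g3 Suc_1 u_def v_def w_def
      del: One_nat_def)
  show "nc4_val P12 = artin_gen 4 1" "nc4_val P23 = artin_gen 4 2" "nc4_val P34 = artin_gen 4 3"
    using b by (simp_all add: x_def y_def z_def del: One_nat_def)
  show "nc4_val s \<in> carrier (braid_group 4)"
    by (cases s) (simp_all add: b del: One_nat_def)
  note r = band_relations4[OF c xy yz xz, folded u_def v_def w_def]
  let ?d = "z \<otimes>\<^bsub>braid_group 4\<^esub> (y \<otimes>\<^bsub>braid_group 4\<^esub> x)"
  \<comment> \<open>The table entries with product \<open>P1234\<close>: factorizations of \<delta>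
    into a band and a rank-two factor, the latter bracketed as in \<open>nc4_val\<close> so that
    each equation matches an entry literally.\<close>
  have d1: "z \<otimes>\<^bsub>braid_group 4\<^esub> y \<otimes>\<^bsub>braid_group 4\<^esub> x = ?d"
    by (simp add: m_assoc)
  have d2: "v \<otimes>\<^bsub>braid_group 4\<^esub> (z \<otimes>\<^bsub>braid_group 4\<^esub> x) = ?d"
    by (simp add: r(4) flip: m_assoc)
  have d3: "v \<otimes>\<^bsub>braid_group 4\<^esub> x \<otimes>\<^bsub>braid_group 4\<^esub> z = ?d"
    using d2 by (simp add: xz m_assoc)
  have d4: "w \<otimes>\<^bsub>braid_group 4\<^esub> (z \<otimes>\<^bsub>braid_group 4\<^esub> y) = ?d"
    using d3 r(4,8) c cu by (metis m_assoc)
  have d5: "x \<otimes>\<^bsub>braid_group 4\<^esub> (z \<otimes>\<^bsub>braid_group 4\<^esub> u) = ?d"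
    using d3 r(6,7) c cu by (metis m_assoc)
  have d6: "y \<otimes>\<^bsub>braid_group 4\<^esub> (v \<otimes>\<^bsub>braid_group 4\<^esub> x) = ?d"
    by (simp add: r(3) flip: m_assoc)
  have d7: "z \<otimes>\<^bsub>braid_group 4\<^esub> x \<otimes>\<^bsub>braid_group 4\<^esub> u = ?d"
    by (simp add: m_assoc r(1))
  have d8: "z \<otimes>\<^bsub>braid_group 4\<^esub> u \<otimes>\<^bsub>braid_group 4\<^esub> y = ?d"
    by (simp add: m_assoc r(2))
  have d9: "u \<otimes>\<^bsub>braid_group 4\<^esub> (y \<otimes>\<^bsub>braid_group 4\<^esub> w) = ?d"
    using d8 r(5,9) c cu by (metis m_assoc)
  have d10: "y \<otimes>\<^bsub>braid_group 4\<^esub> w \<otimes>\<^bsub>braid_group 4\<^esub> v = ?d"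
    by (simp add: m_assoc r(8) d6)
  have d11: "y \<otimes>\<^bsub>braid_group 4\<^esub> x \<otimes>\<^bsub>braid_group 4\<^esub> w = ?d"
    by (simp add: m_assoc r(7) d6)
  show "list_all (\<lambda>((s, t), p). nc4_val s \<otimes>\<^bsub>braid_group 4\<^esub> nc4_val t = nc4_val p) nc4_products"
    unfolding nc4_products_def list.pred_inject prod.case nc4_val.simps b
    by (intro conjI r d1 d2 d3 d4 d5 d6 d7 d8 d9 d10 d11 xz) simp_all
qed

lemma nc3_generated:
  assumes one: "Q N1" and gen: "\<And>i::nat. i \<in> {1..<3} \<Longrightarrow> Q (if i = 1 then N12 else N23)"
    and mult: "\<And>s t p. table_mul N1 nc3_products s t = Some p \<Longrightarrow> Q s \<Longrightarrow> Q t \<Longrightarrow> Q p"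
    and div: "\<And>s t p. table_mul N1 nc3_products s t = Some p \<Longrightarrow> Q p \<Longrightarrow> Q t \<Longrightarrow> Q s"
  shows "Q s"
proof -
  have 1: "Q N12" "Q N23" using gen[of 1] gen[of 2] by simp_all
  have 2: "Q N123" by (rule mult[OF _ 1(2,1)]) (simp add: table_mul_def nc3_products_def)
  have "Q N13" by (rule div[OF _ 2 1(2)]) (simp add: table_mul_def nc3_products_def)
  with 1 2 one show ?thesis by (cases s) simp_all
qed

interpretation nc3: braid_germ N1 N123 "table_mul N1 nc3_products"
  "table_slide N1 nc3_products nc3_slides" nc3_compl 3 nc3_rank 3 nc3_val
  "\<lambda>i. if i = 1 then N12 else N23"
proof
  fix s t p
  show "nc3_val N1 = \<one>\<^bsub>braid_group 3\<^esub>" "nc3_val N123 = delta 3" by simp_all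
  show "nc3_val s \<in> carrier (braid_group 3)" by (rule nc3_val_closed)
  show "nc3_val s \<otimes>\<^bsub>braid_group 3\<^esub> nc3_val t = nc3_val p"
    if "table_mul N1 nc3_products s t = Some p"
    using table_mul_hom[OF nc3_products_val _ group_braid_group nc3_val_closed that] by simp
  show "{nc3_val s |s. nc3_rank s = 1} = {band 3 i j |i j. 1 \<le> i \<and> i < j \<and> j \<le> 3}"
  proof (intro equalityI subsetI)
    fix x assume "x \<in> {nc3_val s |s. nc3_rank s = 1}"
    then obtain s where "nc3_rank s = 1" "x = nc3_val s" by blast
    then show "x \<in> {band 3 i j |i j. 1 \<le> i \<and> i < j \<and> j \<le> 3}"
      by (cases s) (force+)
  next
    fix x assume "x \<in> {band 3 i j |i j. 1 \<le> i \<and> i < j \<and> j \<le> (3::nat)}"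
    then obtain i j :: nat where ij: "x = band 3 i j" "1 \<le> i" "i < j" "j \<le> 3" by blast
    then have "(i = 1 \<and> j = 2) \<or> (i = 1 \<and> j = 3) \<or> (i = 2 \<and> j = 3)" by arith
    then have "x = nc3_val N12 \<or> x = nc3_val N13 \<or> x = nc3_val N23" using ij(1) by auto
    moreover have "nc3_rank N12 = 1" "nc3_rank N13 = 1" "nc3_rank N23 = 1" by simp_all
    ultimately show "x \<in> {nc3_val s |s. nc3_rank s = 1}" by blast
  qed
  show "\<exists>t u. table_mul N1 nc3_products t u = Some s \<and> nc3_rank t = 1" if "1 < nc3_rank s"
  proof -
    have "\<exists>((t, u), p)\<in>set nc3_products. p = s \<and> nc3_rank t = 1"
      using that by (cases s) (simp_all add: nc3_products_def)
    moreover have "list_all (\<lambda>((t, u), p). table_mul N1 nc3_products t u = Some p) nc3_products"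
      by code_simp
    ultimately show ?thesis by (fastforce simp: list_all_iff)
  qed
next
  fix i :: nat assume "i \<in> {1..<3}" "Suc i \<in> {1..<3}"
  then have "i = 1" by simp
  then show "\<exists>c p. table_mul N1 nc3_products (if Suc i = 1 then N12 else N23) (if i = 1 then N12 else N23) = Some p \<and>
      table_mul N1 nc3_products (if i = 1 then N12 else N23) c = Some p \<and>
      table_mul N1 nc3_products c (if Suc i = 1 then N12 else N23) = Some p"
    by (intro exI[of _ N13] exI[of _ N123]) (simp add: table_mul_def nc3_products_def)
next
  fix i :: nat assume "i \<in> {1..<3}"
  then have "i = 1 \<or> i = 2" by auto
  then show "nc3_val (if i = 1 then N12 else N23) = artin_gen 3 i"
    "nc3_rank (if i = 1 then N12 else N23) = 1"
    using nc3_val_gen by auto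
\<comment> \<open>On three strands no two generators are far apart, so \<open>gen_far\<close> is
  vacuous.\<close>
qed (simp, fact nc3_generated)

text \<open>The bands between nonadjacent strands need division: \<open>P13\<close> from P123 = P13
  P23, \<open>P24\<close> from P234 = P24 P34, then \<open>P14\<close> from P134 = P14 P34.\<close>

lemma nc4_generated:
  assumes one: "Q P1" and gen: "\<And>i::nat. i \<in> {1..<4} \<Longrightarrow> Q (if i = 1 then P12 else if i = 2 then P23 else P34)"
    and mult: "\<And>s t p. table_mul P1 nc4_products s t = Some p \<Longrightarrow> Q s \<Longrightarrow> Q t \<Longrightarrow> Q p"
    and div: "\<And>s t p. table_mul P1 nc4_products s t = Some p \<Longrightarrow> Q p \<Longrightarrow> Q t \<Longrightarrow> Q s"
  shows "Q s"
proof -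
  note tab = table_mul_def nc4_products_def
  have Q: "Q P12" "Q P23" "Q P34" using gen[of 1] gen[of 2] gen[of 3] by simp_all
  have P123: "Q P123" by (rule mult[OF _ Q(2,1)]) (simp add: tab)
  have P234: "Q P234" by (rule mult[OF _ Q(3,2)]) (simp add: tab)
  have P12_34: "Q P12_34" by (rule mult[OF _ Q(1,3)]) (simp add: tab)
  have P1234: "Q P1234" by (rule mult[OF _ Q(3) P123]) (simp add: tab)
  have P13: "Q P13" by (rule div[OF _ P123 Q(2)]) (simp add: tab)
  have P24: "Q P24" by (rule div[OF _ P234 Q(3)]) (simp add: tab)
  have P134: "Q P134" by (rule mult[OF _ Q(3) P13]) (simp add: tab)
  have P14: "Q P14" by (rule div[OF _ P134 Q(3)]) (simp add: tab)
  have P124: "Q P124" by (rule mult[OF _ P24 Q(1)]) (simp add: tab)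
  have P14_23: "Q P14_23" by (rule mult[OF _ Q(2) P14]) (simp add: tab)
  show ?thesis
    by (cases s) (simp_all only: one Q P123 P234 P12_34 P1234 P13 P24 P134 P14 P124 P14_23)
qed

interpretation nc4: braid_germ P1 P1234 "table_mul P1 nc4_products"
  "table_slide P1 nc4_products nc4_slides" nc4_compl 4 nc4_rank 4 nc4_val
  "\<lambda>i. if i = 1 then P12 else if i = 2 then P23 else P34"
proof
  fix s t p
  show "nc4_val P1 = \<one>\<^bsub>braid_group 4\<^esub>" "nc4_val P1234 = delta 4" by simp_all
  show "nc4_val s \<in> carrier (braid_group 4)" by (rule nc4_val_closed)
  show "nc4_val s \<otimes>\<^bsub>braid_group 4\<^esub> nc4_val t = nc4_val p"
    if "table_mul P1 nc4_products s t = Some p"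
    using table_mul_hom[OF nc4_products_val _ group_braid_group nc4_val_closed that] by simp
  show "{nc4_val s |s. nc4_rank s = 1} = {band 4 i j |i j. 1 \<le> i \<and> i < j \<and> j \<le> 4}"
  proof (intro equalityI subsetI)
    fix x assume "x \<in> {nc4_val s |s. nc4_rank s = 1}"
    then obtain s where "nc4_rank s = 1" "x = nc4_val s" by blast
    then show "x \<in> {band 4 i j |i j. 1 \<le> i \<and> i < j \<and> j \<le> 4}"
      by (cases s) (force+)
  next
    fix x assume "x \<in> {band 4 i j |i j. 1 \<le> i \<and> i < j \<and> j \<le> (4::nat)}"
    then obtain i j :: nat where ij: "x = band 4 i j" "1 \<le> i" "i < j" "j \<le> 4" by blast
    then have "(i = 1 \<and> j = 2) \<or> (i = 1 \<and> j = 3) \<or> (i = 1 \<and> j = 4) \<or> (i = 2 \<and> j = 3) \<or>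
      (i = 2 \<and> j = 4) \<or> (i = 3 \<and> j = 4)" by arith
    then have "x = nc4_val P12 \<or> x = nc4_val P13 \<or> x = nc4_val P14 \<or> x = nc4_val P23 \<or>
      x = nc4_val P24 \<or> x = nc4_val P34" using ij(1) by auto
    moreover have "nc4_rank P12 = 1" "nc4_rank P13 = 1" "nc4_rank P14 = 1" "nc4_rank P23 = 1"
      "nc4_rank P24 = 1" "nc4_rank P34 = 1" by simp_all
    ultimately show "x \<in> {nc4_val s |s. nc4_rank s = 1}" by blast
  qed
  show "\<exists>t u. table_mul P1 nc4_products t u = Some s \<and> nc4_rank t = 1" if "1 < nc4_rank s"
  proof -
    have "\<exists>((t, u), p)\<in>set nc4_products. p = s \<and> nc4_rank t = 1"
      using that by (cases s) (simp_all add: nc4_products_def)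
    moreover have "list_all (\<lambda>((t, u), p). table_mul P1 nc4_products t u = Some p) nc4_products"
      by code_simp
    ultimately show ?thesis by (fastforce simp: list_all_iff)
  qed
next
  let ?g = "\<lambda>i::nat. if i = 1 then P12 else if i = 2 then P23 else P34"
  fix i :: nat assume "i \<in> {1..<4}" "Suc i \<in> {1..<4}"
  then have "i = 1 \<or> i = 2" by auto
  then show "\<exists>c p. table_mul P1 nc4_products (?g (Suc i)) (?g i) = Some p \<and>
      table_mul P1 nc4_products (?g i) c = Some p \<and>
      table_mul P1 nc4_products c (?g (Suc i)) = Some p"
  proof
    assume "i = 1"
    then show ?thesis
      by (intro exI[of _ P13] exI[of _ P123]) (simp add: table_mul_def nc4_products_def)
  next
    assume "i = 2"
    then show ?thesis
      by (intro exI[of _ P24] exI[of _ P234]) (simp add: table_mul_def nc4_products_def)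
  qed
next
  let ?g = "\<lambda>i::nat. if i = 1 then P12 else if i = 2 then P23 else P34"
  fix i j :: nat assume "i \<in> {1..<4}" "j \<in> {1..<4}" "i + 2 \<le> j"
  then have "i = 1" "j = 3" by auto
  then show "\<exists>p. table_mul P1 nc4_products (?g i) (?g j) = Some p \<and>
      table_mul P1 nc4_products (?g j) (?g i) = Some p"
    by (intro exI[of _ P12_34]) (simp add: table_mul_def nc4_products_def)
next
  fix i :: nat assume "i \<in> {1..<4}"
  then have "i = 1 \<or> i = 2 \<or> i = 3" by auto
  then show "nc4_val (if i = 1 then P12 else if i = 2 then P23 else P34) = artin_gen 4 i"
    "nc4_rank (if i = 1 then P12 else if i = 2 then P23 else P34) = 1"
    using nc4_val_gen by auto
qed (fact nc4_generated)

theorem theorem1p4: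
  shows
    "(\<forall>\<beta>\<in>carrier (braid_group 3). \<beta> \<notin> conj_class 3 (inv\<^bsub>braid_group 3\<^esub> delta 3) \<longrightarrow>
        (conj_ASQP 3 \<beta> \<and> \<not> conj_SQP 3 \<beta> \<longleftrightarrow>
          (\<forall>\<beta>'\<in>super_summit_set 3 \<beta>. braid_inf 3 \<beta>' = -1))) \<and>
     (\<forall>\<beta>\<in>carrier (braid_group 4).
        (conj_ASQP 4 \<beta> \<and> \<not> conj_SQP 4 \<beta> \<longleftrightarrow>
          (\<forall>\<beta>'\<in>super_summit_set 4 \<beta>. braid_inf 4 \<beta>' = -1 \<and>
             (\<exists>As. left_canonical_form 4 \<beta>' (-1) As \<and> (\<exists>A\<in>set As. band_length 4 A = 2)))))"
  by (intro conjI ballI impI nc3.conj_ASQP_iff_rank2 nc4.conj_ASQP_iff_rank3) simp_all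

end
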